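(* Let $V$ be an irreducible uniformly bounded weight module for $(\mathcal{S}_N\ltimes A_N)\otimes B$ on which $t^{\mathbf{0}}$ acts non-trivially and $t^{\mathbf{r}}$ acts non-trivially for some $\mathbf{r}\ne\mathbf{0}$. For $\mathbf{m},\mathbf{n}\in\mathbb{Z}^N$ and $b,b'\in B$ let $\lambda_{\mathbf{m},\mathbf{n},b,b'}$ be the eigenvalue of the matrix $\mathbf{B}_{\mathbf{m},\mathbf{n},b,b'}$ defined in the context. Then $$t^{\mathbf{m}}b\cdot t^{\mathbf{n}}b'=\lambda_{\mathbf{m},\mathbf{n},b,b'}\,t^{\mathbf{m}+\mathbf{n}}\quad\text{on }V$$ for all $\mathbf{m},\mathbf{n}\in\mathbb{Z}^N$ and $b,b'\in B$.
   Context: All vector spaces, algebras and tensor products are over $\mathbb{C}$; $B$ is a finitely generated commutative associative unital algebra; $N\ge 2$ is an integer. $A_N=\mathbb{C}[t_1^{\pm1},\dots,t_N^{\pm1}]$, $t^{\mathbf{m}}=t_1^{m_1}\cdots t_N^{m_N}$, $d_i=t_i\frac{d}{dt_i}$, $(x|y)=\sum_ix_iy_i$. For $u\in\mathbb{C}^N$, $\mathbf{r}\in\mathbb{Z}^N$ put $D(u,\mathbf{r})=\sum_iu_it^{\mathbf{r}}d_i$; $\mathcal{S}_N=\mathrm{span}\{D(u,\mathbf{r})\mid(u|\mathbf{r})=0\}$ with $[D(u,\mathbf{r}),D(v,\mathbf{s})]=D((u|\mathbf{s})v-(v|\mathbf{r})u,\mathbf{r}+\mathbf{s})$. In $\mathcal{S}_N\ltimes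 A_N$, $A_N$ is an abelian ideal and $[D(u,\mathbf{r}),t^{\mathbf{s}}]=(u|\mathbf{s})t^{\mathbf{r}+\mathbf{s}}$. For a Lie algebra $\mathfrak{g}$, $\mathfrak{g}\otimes B$ has bracket $[x\otimes b_1,y\otimes b_2]=[x,y]\otimes b_1b_2$; write $xb=x\otimes b$ and $x=x\otimes1$. $\mathfrak{h}=\mathrm{span}\{d_1,\dots,d_N\}$. A uniformly bounded weight module is a module $V=\bigoplus_{\lambda\in\mathfrak{h}^*}V_\lambda$, $V_\lambda=\{v\mid hv=\lambda(h)v\ \forall h\in\mathfrak{h}\}$, for which there is a positive integer $M$ with $\dim V_\lambda\le M$ for all $\lambda$. Fix a weight $\lambda$ of $V$ and put $\Lambda=(\lambda(d_i))_{i=1}^N$; then $V=\bigoplus_{\mathbf{r}\in\mathbb{Z}^N}V_{\Lambda+\mathbf{r}}$ with $V_{\Lambda+\mathbf{r}}=\{v\mid d_iv=(\lambda(d_i)+r_i)v\ \forall i\}$. Under the hypotheses of the claim every $t^{\mathbf{r}}$ acts injectively on $V$ and all $V_{\Lambda+\mathbf{r}}$ have the same dimension $m$. Fix a basis $v_1,\dots,v_m$ of $V_\Lambda$ and put $v_i(\mathbf{r})=t^{\mathbf{r}}v_i$, so that $(v_i(\mathbf{r}))_{i=1}^m$ is a basis of $V_{\Lambda+\mathbf{r}}$. The $m\times m$ matrix $\mathbf{B}_{\mathbf{m},\mathbf{n},b,b'}$ is defined by $$t^{\mathbf{m}}b\cdot t^{\mathbf{n}}b'\cdot(v_i)_{i=1}^m=(v_i(\mathbf{m}+\mathbf{n}))_{i=1}^m\,\mathbf{B}_{\mathbf{m},\mathbf{n},b,b'}.$$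 "The eigenvalue" means any eigenvalue of this matrix (it has only one). *)

theory Defs
  imports
    "HOL-Analysis.Finite_Cartesian_Product"
    "HOL-Library.Poly_Mapping"
    "HOL-Library.Function_Algebras"
    "HOL-Library.Product_Plus"
    "Jordan_Normal_Form.Char_Poly"
begin

section \<open>Complex vector spaces and algebras\<close>

class complex_vector = ab_group_add +
  fixes scaleC :: "complex \<Rightarrow> 'a \<Rightarrow> 'a"  (infixr \<open>*\<^sub>C\<close> 75)
  assumes scaleC_add_right: "c *\<^sub>C (x + y) = c *\<^sub>C x + c *\<^sub>C y"
    and scaleC_add_left: "(c + c') *\<^sub>C x = c *\<^sub>C x + c' *\<^sub>C x"
    and scaleC_scaleC: "c *\<^sub>C (c' *\<^sub>C x) = (c * c') *\<^sub>C x"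
    and scaleC_one: "1 *\<^sub>C x = x"

global_interpretation cvec: vector_space "scaleC :: complex \<Rightarrow> 'a \<Rightarrow> 'a::complex_vector"
  defines cdependent = cvec.dependent
    and csubspace = cvec.subspace
    and cspan = cvec.span
  by unfold_locales (simp_all add: scaleC_add_right scaleC_add_left scaleC_scaleC scaleC_one)

abbreviation clinear :: "('a::complex_vector \<Rightarrow> 'b::complex_vector) \<Rightarrow> bool"
  where "clinear \<equiv> Vector_Spaces.linear scaleC scaleC"

lemma clinear_iff:
  fixes f :: "'a::complex_vector \<Rightarrow> 'b::complex_vector"
  shows "clinear f \<longleftrightarrow> (\<forall>x y. f (x + y) = f x + f y) \<and> (\<forall>c x. f (c *\<^sub>C x) = c *\<^sub>C f x)"
  unfolding Vector_Spaces.linear_def module_hom_def module_hom_axioms_def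
  by (simp add: cvec.vector_space_axioms cvec.module_axioms)

instantiation complex :: complex_vector
begin
definition scaleC_complex :: "complex \<Rightarrow> complex \<Rightarrow> complex"
  where "scaleC_complex c x = c * x"
instance by standard (simp_all add: scaleC_complex_def algebra_simps)
end

instantiation "fun" :: (type, complex_vector) complex_vector
begin
definition scaleC_fun :: "complex \<Rightarrow> ('a \<Rightarrow> 'b) \<Rightarrow> 'a \<Rightarrow> 'b"
  where "scaleC_fun c f = (\<lambda>x. c *\<^sub>C f x)"
instance
  by standard
    (simp_all add: scaleC_fun_def fun_eq_iff scaleC_add_right scaleC_add_left scaleC_scaleC scaleC_one)
end

instantiation prod :: (complex_vector, complex_vector) complex_vector
begin
definition scaleC_prod :: "complex \<Rightarrow> 'a \<times> 'b \<Rightarrow> 'a \<times> 'b"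
  where "scaleC_prod c p = (c *\<^sub>C fst p, c *\<^sub>C snd p)"
instance
  by standard
    (simp_all add: scaleC_prod_def prod_eq_iff scaleC_add_right scaleC_add_left scaleC_scaleC scaleC_one)
end

instantiation poly_mapping :: (type, complex_vector) complex_vector
begin
lift_definition scaleC_poly_mapping :: "complex \<Rightarrow> ('a \<Rightarrow>\<^sub>0 'b) \<Rightarrow> 'a \<Rightarrow>\<^sub>0 'b"
  is "\<lambda>c f k. c *\<^sub>C f k"
proof -
  fix c and f :: "'a \<Rightarrow> 'b"
  assume "finite {k. f k \<noteq> 0}"
  then show "finite {k. c *\<^sub>C f k \<noteq> 0}"
    by (rule rev_finite_subset) auto
qed
instance
  by standard
    (transfer; simp add: fun_eq_iff scaleC_add_right scaleC_add_left scaleC_scaleC scaleC_one)+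
end

class complex_comm_algebra = complex_vector + comm_ring_1 +
  assumes scaleC_mult_left: "(c *\<^sub>C x) * y = c *\<^sub>C (x * y)"

definition subalgebra :: "'b::complex_comm_algebra set \<Rightarrow> bool"
  where "subalgebra S \<longleftrightarrow> csubspace S \<and> 1 \<in> S \<and> (\<forall>x\<in>S. \<forall>y\<in>S. x * y \<in> S)"

definition finitely_generated_algebra :: "'b::complex_comm_algebra itself \<Rightarrow> bool"
  where "finitely_generated_algebra _ \<longleftrightarrow>
    (\<exists>G :: 'b set. finite G \<and> \<Inter>{S. subalgebra S \<and> G \<subseteq> S} = UNIV)"

class lie_algebra = complex_vector +
  fixes lie :: "'a \<Rightarrow> 'a \<Rightarrow> 'a"
  assumes lie_add_left: "lie (x + y) z = lie x z + lie y z"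
    and lie_add_right: "lie x (y + z) = lie x y + lie x z"
    and lie_scaleC_left: "lie (c *\<^sub>C x) y = c *\<^sub>C lie x y"
    and lie_scaleC_right: "lie x (c *\<^sub>C y) = c *\<^sub>C lie x y"
    and lie_self: "lie x x = 0"
    and jacobi: "lie x (lie y z) + lie y (lie z x) + lie z (lie x y) = 0"


section \<open>The tensor product of two complex vector spaces\<close>

text \<open>The free vector space on \<open>'a \<times> 'b\<close> modulo the bilinearity relations.\<close>

definition tensor_relations :: "(('a::complex_vector \<times> 'b::complex_vector) \<Rightarrow>\<^sub>0 complex) set"
  where "tensor_relations = cspan (
    {Poly_Mapping.single (x + x', y) 1 - Poly_Mapping.single (x, y) 1
       - Poly_Mapping.single (x', y) 1 | x x' y. True} \<union>
    {Poly_Mapping.single (x, y + y') 1 - Poly_Mapping.single (x, y) 1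
       - Poly_Mapping.single (x, y') 1 | x y y'. True} \<union>
    {Poly_Mapping.single (c *\<^sub>C x, y) 1 - c *\<^sub>C Poly_Mapping.single (x, y) 1 | c x y. True} \<union>
    {Poly_Mapping.single (x, c *\<^sub>C y) 1 - c *\<^sub>C Poly_Mapping.single (x, y) 1 | c x y. True})"

quotient_type (overloaded) ('a, 'b) tensor =
  "('a::complex_vector \<times> 'b::complex_vector) \<Rightarrow>\<^sub>0 complex" / "\<lambda>p q. p - q \<in> tensor_relations"
proof (rule equivpI)
  show "reflp (\<lambda>p q :: ('a \<times> 'b) \<Rightarrow>\<^sub>0 complex. p - q \<in> tensor_relations)"
    by (auto simp: reflp_def tensor_relations_def cvec.span_zero)
  show "symp (\<lambda>p q :: ('a \<times> 'b) \<Rightarrow>\<^sub>0 complex. p - q \<in> tensor_relations)"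
    unfolding symp_def tensor_relations_def
  proof (intro allI impI)
    fix p q :: "('a \<times> 'b) \<Rightarrow>\<^sub>0 complex" and R
    assume "p - q \<in> cspan R"
    from cvec.span_neg[OF this] show "q - p \<in> cspan R" by simp
  qed
  show "transp (\<lambda>p q :: ('a \<times> 'b) \<Rightarrow>\<^sub>0 complex. p - q \<in> tensor_relations)"
    unfolding transp_def tensor_relations_def
  proof (intro allI impI)
    fix p q r :: "('a \<times> 'b) \<Rightarrow>\<^sub>0 complex" and R
    assume "p - q \<in> cspan R" "q - r \<in> cspan R"
    from cvec.span_add[OF this] show "p - r \<in> cspan R" by simp
  qed
qed

lemma tensor_relations_add: "p \<in> tensor_relations \<Longrightarrow> q \<in> tensor_relations \<Longrightarrow> p + q \<in> tensor_relations"
  and tensor_relations_diff: "p \<in> tensor_relations \<Longrightarrow> q \<in> tensor_relations \<Longrightarrow> p - q \<in> tensor_relations"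
  and tensor_relations_uminus: "p \<in> tensor_relations \<Longrightarrow> - p \<in> tensor_relations"
  and tensor_relations_scaleC: "p \<in> tensor_relations \<Longrightarrow> c *\<^sub>C p \<in> tensor_relations"
  and tensor_relations_zero: "0 \<in> tensor_relations"
  by (auto simp: tensor_relations_def cvec.span_add cvec.span_diff cvec.span_neg
      cvec.span_scale cvec.span_zero)

instantiation tensor :: (complex_vector, complex_vector) complex_vector
begin
lift_definition zero_tensor :: "('a, 'b) tensor" is 0 .
lift_definition plus_tensor :: "('a, 'b) tensor \<Rightarrow> ('a, 'b) tensor \<Rightarrow> ('a, 'b) tensor" is "(+)"
  by (drule (1) tensor_relations_add) (simp add: algebra_simps)
lift_definition minus_tensor :: "('a, 'b) tensor \<Rightarrow> ('a, 'b) tensor \<Rightarrow> ('a, 'b) tensor" is "(-)"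
  by (drule (1) tensor_relations_diff) (simp add: algebra_simps)
lift_definition uminus_tensor :: "('a, 'b) tensor \<Rightarrow> ('a, 'b) tensor" is uminus
  by (drule tensor_relations_uminus) (simp add: algebra_simps)
lift_definition scaleC_tensor :: "complex \<Rightarrow> ('a, 'b) tensor \<Rightarrow> ('a, 'b) tensor" is scaleC
  by (drule tensor_relations_scaleC) (simp add: cvec.scale_right_diff_distrib)
instance
  by standard
    (transfer; simp add: algebra_simps tensor_relations_zero
      scaleC_add_right scaleC_add_left scaleC_scaleC scaleC_one)+
end

lift_definition tens :: "'a::complex_vector \<Rightarrow> 'b::complex_vector \<Rightarrow> ('a, 'b) tensor"
  is "\<lambda>x y. Poly_Mapping.single (x, y) 1" .

lemma tens_add_left: "tens (x + x') y = tens x y + tens x' y"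
  and tens_add_right: "tens x (y + y') = tens x y + tens x y'"
  and tens_scaleC_left: "tens (c *\<^sub>C x) y = c *\<^sub>C tens x y"
  and tens_scaleC_right: "tens x (c *\<^sub>C y) = c *\<^sub>C tens x y"
  by (transfer, unfold tensor_relations_def, rule cvec.span_base,
      force simp: algebra_simps diff_diff_eq2)+

lemma poly_mapping_add_induct [case_names zero single add]:
  fixes p :: "'a \<Rightarrow>\<^sub>0 'b::comm_monoid_add"
  assumes "P 0" and "\<And>k c. P (Poly_Mapping.single k c)" and "\<And>p q. P p \<Longrightarrow> P q \<Longrightarrow> P (p + q)"
  shows "P p"
proof (induction p rule: Poly_Mapping.update_induct)
  case (update p k c)
  have "Poly_Mapping.update k c p = Poly_Mapping.single k c + p"
    using update.hyps
    by (intro poly_mapping_eqI) (auto simp: lookup_update lookup_add lookup_single in_keys_iff when_def)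
  then show ?case using assms update.IH by simp
qed (fact assms(1))

lemma single_scaleC: "Poly_Mapping.single k c = c *\<^sub>C Poly_Mapping.single k (1::complex)"
  by transfer (auto simp: fun_eq_iff when_def scaleC_complex_def)

lemma tensor_induct [case_names zero tens add, induct type: tensor]:
  fixes T :: "('a::complex_vector, 'b::complex_vector) tensor"
  assumes "P 0" and "\<And>x y. P (tens x y)" and "\<And>S T. P S \<Longrightarrow> P T \<Longrightarrow> P (S + T)"
  shows "P T"
proof (induction T rule: tensor.abs_induct)
  fix p :: "('a \<times> 'b) \<Rightarrow>\<^sub>0 complex"
  show "P (abs_tensor p)"
  proof (induction p rule: poly_mapping_add_induct)
    case zero
    then show ?case using assms(1) by (simp add: zero_tensor.abs_eq)
  next
    case (single k c)
    obtain x y where k: "k = (x, y)" by (cases k)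
    have "tens (c *\<^sub>C x) y = abs_tensor (c *\<^sub>C Poly_Mapping.single k 1)"
      by (simp only: k tens_scaleC_left) (simp add: scaleC_tensor.abs_eq tens.abs_eq)
    then have "abs_tensor (Poly_Mapping.single k c) = tens (c *\<^sub>C x) y"
      by (simp only: single_scaleC[of k c])
    then show ?case using assms(2) by simp
  next
    case (add p q)
    then show ?case using assms(3) by (simp add: plus_tensor.abs_eq[symmetric])
  qed
qed

text \<open>The linear map induced by a bilinear map \<open>\<beta>\<close> (universal property, \<open>tensor_lift_tens\<close>).\<close>

definition free_lift ::
    "('a \<Rightarrow> 'b \<Rightarrow> 'w::complex_vector) \<Rightarrow> (('a \<times> 'b) \<Rightarrow>\<^sub>0 complex) \<Rightarrow> 'w"
  where "free_lift \<beta> p =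
    (\<Sum>k\<in>Poly_Mapping.keys p. Poly_Mapping.lookup p k *\<^sub>C \<beta> (fst k) (snd k))"

definition tensor_lift ::
    "('a::complex_vector \<Rightarrow> 'b::complex_vector \<Rightarrow> 'w::complex_vector) \<Rightarrow> ('a, 'b) tensor \<Rightarrow> 'w"
  where "tensor_lift \<beta> T = free_lift \<beta> (rep_tensor T)"

definition bilinear_map ::
    "('a::complex_vector \<Rightarrow> 'b::complex_vector \<Rightarrow> 'w::complex_vector) \<Rightarrow> bool"
  where "bilinear_map \<beta> \<longleftrightarrow> (\<forall>x. clinear (\<beta> x)) \<and> (\<forall>y. clinear (\<lambda>x. \<beta> x y))"

lemma free_lift_superset:
  assumes "finite A" "Poly_Mapping.keys p \<subseteq> A"
  shows "free_lift \<beta> p = (\<Sum>k\<in>A. Poly_Mapping.lookup p k *\<^sub>C \<beta> (fst k) (snd k))"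
  unfolding free_lift_def
  by (rule sum.mono_neutral_left) (use assms in \<open>auto simp: in_keys_iff\<close>)

lemma free_lift_add: "free_lift \<beta> (p + q) = free_lift \<beta> p + free_lift \<beta> q"
proof -
  let ?A = "Poly_Mapping.keys p \<union> Poly_Mapping.keys q"
  have fin: "finite ?A" by simp
  have "Poly_Mapping.keys (p + q) \<subseteq> ?A" by (rule Poly_Mapping.keys_add)
  then show ?thesis
    by (simp add: free_lift_superset[OF fin] lookup_add scaleC_add_left sum.distrib)
qed

lemma free_lift_scaleC: "free_lift \<beta> (c *\<^sub>C p) = c *\<^sub>C free_lift \<beta> p"
proof -
  have fin: "finite (Poly_Mapping.keys p)" by simp
  have lk: "Poly_Mapping.lookup (c *\<^sub>C p) k = c * Poly_Mapping.lookup p k" for k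
    by transfer (simp add: scaleC_complex_def)
  then have "Poly_Mapping.keys (c *\<^sub>C p) \<subseteq> Poly_Mapping.keys p"
    by (auto simp: in_keys_iff)
  then show ?thesis
    by (simp add: free_lift_superset[OF fin] lk cvec.scale_sum_right scaleC_scaleC)
qed

lemma free_lift_diff: "free_lift \<beta> (p - q) = free_lift \<beta> p - free_lift \<beta> q"
  using free_lift_add[of \<beta> "p - q" q] by (simp add: algebra_simps)

lemma free_lift_zero: "free_lift \<beta> 0 = 0"
  by (simp add: free_lift_def)

lemma free_lift_single: "free_lift \<beta> (Poly_Mapping.single (x, y) 1) = \<beta> x y"
  by (simp add: free_lift_def scaleC_one)

lemma free_lift_relations:
  assumes "bilinear_map \<beta>" "p \<in> tensor_relations"
  shows "free_lift \<beta> p = 0"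
  using assms(2) unfolding tensor_relations_def
proof (induction rule: cvec.span_induct)
  case base
  then show ?case
    by (auto simp: cvec.subspace_def free_lift_add free_lift_scaleC free_lift_zero)
next
  case (step p)
  then show ?case using assms(1)
    by (auto simp: bilinear_map_def clinear_iff free_lift_diff free_lift_scaleC free_lift_single)
qed

lemma tensor_lift_abs:
  assumes "bilinear_map \<beta>"
  shows "tensor_lift \<beta> (abs_tensor p) = free_lift \<beta> p"
proof -
  have "rep_tensor (abs_tensor p) - p \<in> tensor_relations"
    by (rule Quotient3_rep_abs[OF Quotient3_tensor]) (simp add: tensor_relations_zero)
  then show ?thesis
    using free_lift_relations[OF assms] by (fastforce simp: tensor_lift_def free_lift_diff)
qed

lemma tensor_lift_tens: "bilinear_map \<beta> \<Longrightarrow> tensor_lift \<beta> (tens x y) = \<beta> x y"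
  by (simp add: tens.abs_eq tensor_lift_abs free_lift_single)

lemma tensor_lift_linear:
  assumes "bilinear_map \<beta>" shows "clinear (tensor_lift \<beta>)"
proof -
  have "tensor_lift \<beta> (S + T) = tensor_lift \<beta> S + tensor_lift \<beta> T" for S T
    by (induction S rule: tensor.abs_induct, induction T rule: tensor.abs_induct)
      (simp add: plus_tensor.abs_eq tensor_lift_abs[OF assms] free_lift_add)
  moreover have "tensor_lift \<beta> (c *\<^sub>C T) = c *\<^sub>C tensor_lift \<beta> T" for c T
    by (induction T rule: tensor.abs_induct)
      (simp add: scaleC_tensor.abs_eq tensor_lift_abs[OF assms] free_lift_scaleC)
  ultimately show ?thesis by (simp add: clinear_iff)
qed

lemma scaleC_mult_right: "x * (c *\<^sub>C y) = c *\<^sub>C (x * y)" for x y :: "'b::complex_comm_algebra"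
  by (metis mult.commute scaleC_mult_left)

text \<open>The bracket determined by \<open>[x \<otimes> b, y \<otimes> b'] = [x, y] \<otimes> b b'\<close>
  (see \<open>lie_tens\<close>).\<close>

definition tens_bracket ::
    "'a::lie_algebra \<Rightarrow> 'b::complex_comm_algebra \<Rightarrow> ('a, 'b) tensor \<Rightarrow> ('a, 'b) tensor"
  where "tens_bracket x b = tensor_lift (\<lambda>y b'. tens (lie x y) (b * b'))"

lemma tens_bracket_linear: "clinear (tens_bracket x b)"
  and tens_bracket_tens: "tens_bracket x b (tens y b') = tens (lie x y) (b * b')"
proof -
  have "bilinear_map (\<lambda>y b'. tens (lie x y) (b * b') :: ('a, 'b) tensor)"
    by (simp add: bilinear_map_def clinear_iff lie_add_right lie_scaleC_right distrib_left
        scaleC_mult_right tens_add_left tens_add_right tens_scaleC_left tens_scaleC_right)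
  then show "clinear (tens_bracket x b)" "tens_bracket x b (tens y b') = tens (lie x y) (b * b')"
    unfolding tens_bracket_def by (rule tensor_lift_linear, rule tensor_lift_tens)
qed

lemmas tens_bracket_simps = tens_bracket_tens
  tens_bracket_linear[unfolded clinear_iff, THEN conjunct1, rule_format]
  tens_bracket_linear[unfolded clinear_iff, THEN conjunct2, rule_format]

lemma tens_bracket_zero: "tens_bracket x b 0 = 0"
  using tens_bracket_simps(3)[of x b 0 0] by simp

lemma tens_bracket_bilinear: "bilinear_map (\<lambda>x b. tens_bracket x b T)"
proof -
  have "tens_bracket x (b + b') T = tens_bracket x b T + tens_bracket x b' T" for x b b'
    by (induction T rule: tensor_induct)
      (simp_all add: tens_bracket_zero tens_bracket_simps distrib_right tens_add_right add_ac)
  moreover have "tens_bracket (x + x') b T = tens_bracket x b T + tens_bracket x' b T" for x x' b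
    by (induction T rule: tensor_induct)
      (simp_all add: tens_bracket_zero tens_bracket_simps lie_add_left tens_add_left add_ac)
  moreover have "tens_bracket x (c *\<^sub>C b) T = c *\<^sub>C tens_bracket x b T" for x b c
    by (induction T rule: tensor_induct)
      (simp_all add: tens_bracket_zero tens_bracket_simps scaleC_mult_left tens_scaleC_right
        scaleC_add_right)
  moreover have "tens_bracket (c *\<^sub>C x) b T = c *\<^sub>C tens_bracket x b T" for x b c
    by (induction T rule: tensor_induct)
      (simp_all add: tens_bracket_zero tens_bracket_simps lie_scaleC_left tens_scaleC_left
        scaleC_add_right)
  ultimately show ?thesis by (simp add: bilinear_map_def clinear_iff)
qed

instantiation tensor :: (lie_algebra, complex_comm_algebra) lie_algebra
begin

definition lie_tensor :: "('a, 'b) tensor \<Rightarrow> ('a, 'b) tensor \<Rightarrow> ('a, 'b) tensor"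
  where "lie_tensor S T = tensor_lift (\<lambda>x b. tens_bracket x b T) S"

lemma lie_tens_left: "lie (tens x b) T = tens_bracket x b T"
  unfolding lie_tensor_def by (rule tensor_lift_tens[OF tens_bracket_bilinear])

lemma lie_tens: "lie (tens x b) (tens y b') = tens (lie x y) (b * b')"
  by (simp add: lie_tens_left tens_bracket_simps)

instance
proof
  fix x y z :: "('a, 'b) tensor" and c
  note lin = tensor_lift_linear[OF tens_bracket_bilinear, unfolded clinear_iff]
  show add_left: "lie (x + y) z = lie x z + lie y z" for x y z :: "('a, 'b) tensor"
    by (simp add: lie_tensor_def lin)
  show scale_left: "lie (c *\<^sub>C x) y = c *\<^sub>C lie x y" for c and x y :: "('a, 'b) tensor"
    by (simp add: lie_tensor_def lin)
  have zero_left: "lie 0 y = 0" for y :: "('a, 'b) tensor"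
    using scale_left[of 0 0 y] by simp
  show add_right: "lie x (y + z) = lie x y + lie x z" for x y z :: "('a, 'b) tensor"
  proof (induction x rule: tensor_induct)
    case (tens x b)
    show ?case by (simp add: lie_tens_left tens_bracket_simps)
  qed (simp_all add: zero_left add_left add_ac)
  show scale_right: "lie x (c *\<^sub>C y) = c *\<^sub>C lie x y" for c and x y :: "('a, 'b) tensor"
  proof (induction x rule: tensor_induct)
    case (tens x b)
    show ?case by (simp add: lie_tens_left tens_bracket_simps)
  qed (simp_all add: zero_left add_left scaleC_add_right)
  have zero_right: "lie y 0 = 0" for y :: "('a, 'b) tensor"
    using scale_right[of y 0 0] by simp
  have tens_zero: "tens 0 b = (0 :: ('a, 'b) tensor)" for b
    using tens_scaleC_left[of 0 0 b] by simp
  have anti: "lie a b + lie b a = 0" for a b :: 'a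
  proof -
    have "lie (a + b) (a + b) = lie a a + lie b b + (lie a b + lie b a)"
      by (simp only: lie_add_left lie_add_right add_ac)
    then show ?thesis by (simp only: lie_self add_0)
  qed
  have skew: "lie x y + lie y x = 0" for x y :: "('a, 'b) tensor"
  proof (induction x rule: tensor_induct)
    case (tens a b)
    show ?case
    proof (induction y rule: tensor_induct)
      case (tens a' b')
      show ?case
        using tens_add_left[of "lie a a'" "lie a' a" "b * b'", symmetric]
        by (simp add: lie_tens anti tens_zero mult.commute)
    next
      case (add S T)
      have "lie (tens a b) (S + T) + lie (S + T) (tens a b)
          = (lie (tens a b) S + lie S (tens a b)) + (lie (tens a b) T + lie T (tens a b))"
        by (simp only: add_left add_right add_ac)
      then show ?case using add by simp
    qed (simp add: zero_left zero_right)
  next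
    case (add S T)
    have "lie (S + T) y + lie y (S + T) = (lie S y + lie y S) + (lie T y + lie y T)"
      by (simp only: add_left add_right add_ac)
    then show ?case using add by simp
  qed (simp add: zero_left zero_right)
  show "lie x x = 0"
  proof (induction x rule: tensor_induct)
    case (add S T)
    then show ?case using skew[of T S] by (simp add: add_left add_right)
  qed (simp_all add: zero_left lie_tens lie_self tens_zero)
  define J where "J x y z = lie x (lie y z) + lie y (lie z x) + lie z (lie x y)"
    for x y z :: "('a, 'b) tensor"
  have J1: "J (x + x') y z = J x y z + J x' y z" for x x' y z
    by (simp add: J_def add_left add_right add_ac)
  have J2: "J x (y + y') z = J x y z + J x y' z" for x y y' z
    by (simp add: J_def add_left add_right add_ac)
  have J3: "J x y (z + z') = J x y z + J x y z'" for x y z z'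
    by (simp add: J_def add_left add_right add_ac)
  have "J x y z = 0"
  proof (induction x rule: tensor_induct)
    case xt: (tens a b)
    show ?case
    proof (induction y rule: tensor_induct)
      case yt: (tens a' b')
      show ?case
      proof (induction z rule: tensor_induct)
        case (tens a'' b'')
        have "J (tens a b) (tens a' b') (tens a'' b'')
            = tens (lie a (lie a' a'') + lie a' (lie a'' a) + lie a'' (lie a a')) (b * b' * b'')"
          by (simp add: J_def lie_tens tens_add_left mult_ac)
        then show ?case by (simp add: jacobi tens_zero)
      qed (simp_all add: J3, simp add: J_def zero_left zero_right)
    qed (simp_all add: J2, simp add: J_def zero_left zero_right)
  qed (simp_all add: J1, simp add: J_def zero_left zero_right)
  then show "lie x (lie y z) + lie y (lie z x) + lie z (lie x y) = 0"
    by (simp add: J_def)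
qed

end


section \<open>The Lie algebra \<open>S\<^sub>N \<ltimes> A\<^sub>N\<close>\<close>

text \<open>
  \<open>N\<close> is \<open>CARD('n)\<close>. A Laurent polynomial is its finitely supported coefficient function on the
  exponent lattice, with the convolution product of \<open>poly_mapping\<close>.
\<close>

type_synonym 'n laurent = "(int ^ 'n) \<Rightarrow>\<^sub>0 complex"

definition monomial :: "int ^ 'n \<Rightarrow> 'n::finite laurent"
  where "monomial r = Poly_Mapping.single r 1"

definition pairing :: "complex ^ 'n \<Rightarrow> int ^ 'n::finite \<Rightarrow> complex"
  where "pairing u r = (\<Sum>i\<in>UNIV. vec_nth u i * of_int (vec_nth r i))"

text \<open>\<open>t\<^sub>i d/dt\<^sub>i\<close> multiplies the coefficient of \<open>t\<^sup>r\<close> by \<open>r\<^sub>i\<close>.\<close>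

lift_definition euler_op :: "'n \<Rightarrow> 'n::finite laurent \<Rightarrow> 'n laurent"
  is "\<lambda>i f r. of_int (vec_nth r i) * f r"
proof -
  fix i and f :: "int ^ 'n \<Rightarrow> complex"
  assume "finite {r. f r \<noteq> 0}"
  then show "finite {r. of_int (vec_nth r i) * f r \<noteq> 0}"
    by (rule rev_finite_subset) auto
qed

definition D_op :: "complex ^ 'n \<Rightarrow> int ^ 'n \<Rightarrow> 'n::finite laurent \<Rightarrow> 'n laurent"
  where "D_op u r f = (\<Sum>i\<in>UNIV. vec_nth u i *\<^sub>C (monomial r * euler_op i f))"

text \<open>
  \<open>S\<^sub>N\<close> is realised as a Lie algebra of derivations of \<open>A\<^sub>N\<close> under the commutator; the structure
  constants are computed in \<open>D_op_commutator\<close>.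
\<close>

definition S_alg :: "('n::finite laurent \<Rightarrow> 'n laurent) set"
  where "S_alg = cspan {D_op u r | u r. pairing u r = 0}"

lemma euler_op_monomial: "euler_op i (monomial r) = of_int (vec_nth r i) *\<^sub>C monomial r"
  unfolding monomial_def by transfer (auto simp: fun_eq_iff when_def scaleC_complex_def)

lemma euler_op_add: "euler_op i (f + g) = euler_op i f + euler_op i g"
  by transfer (simp add: fun_eq_iff distrib_left)

lemma euler_op_scaleC: "euler_op i (c *\<^sub>C f) = c *\<^sub>C euler_op i f"
  by transfer (simp add: fun_eq_iff scaleC_complex_def)

lemma laurent_scaleC_times: "c *\<^sub>C f = Poly_Mapping.single 0 c * f" for f :: "'n::finite laurent"
proof (induction f rule: poly_mapping_add_induct)
  case (single k d)
  show ?case by (simp add: mult_single)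
    (transfer, auto simp: fun_eq_iff when_def scaleC_complex_def)
qed (simp_all add: scaleC_add_right distrib_left)

lemma laurent_mult_scaleC:
  fixes f g :: "'n::finite laurent"
  shows "(c *\<^sub>C f) * g = c *\<^sub>C (f * g)" and "f * (c *\<^sub>C g) = c *\<^sub>C (f * g)"
  by (simp_all add: laurent_scaleC_times mult_ac)

lemma monomial_mult: "monomial r * monomial s = monomial (r + s)"
  by (simp add: monomial_def mult_single)

lemma D_op_linear: "clinear (D_op u r)"
  by (simp add: clinear_iff D_op_def euler_op_add euler_op_scaleC distrib_left scaleC_add_right
      sum.distrib cvec.scale_sum_right scaleC_scaleC laurent_mult_scaleC mult.commute)

lemma D_op_zero: "D_op u r 0 = 0"
  using D_op_linear[of u r, unfolded clinear_iff, THEN conjunct2, rule_format, of 0 0] by simp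

lemma D_op_monomial: "D_op u r (monomial s) = pairing u s *\<^sub>C monomial (r + s)"
  by (simp add: D_op_def euler_op_monomial pairing_def cvec.scale_sum_left laurent_mult_scaleC
      monomial_mult scaleC_scaleC)

lemma laurent_linear_eqI:
  fixes X Y :: "'n::finite laurent \<Rightarrow> 'v::complex_vector"
  assumes "clinear X" "clinear Y" "\<And>r. X (monomial r) = Y (monomial r)"
  shows "X = Y"
proof
  fix f
  have zero: "X 0 = 0" "Y 0 = 0"
    using assms(1,2)[unfolded clinear_iff, THEN conjunct2, rule_format, of 0 0] by simp_all
  show "X f = Y f"
  proof (induction f rule: poly_mapping_add_induct)
    case (single k c)
    have "Poly_Mapping.single k c = c *\<^sub>C monomial k"
      unfolding monomial_def by (rule single_scaleC)
    then show ?case using assms by (simp add: clinear_iff)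
  qed (use zero assms in \<open>simp_all add: clinear_iff\<close>)
qed

definition commutator :: "('v::ab_group_add \<Rightarrow> 'v) \<Rightarrow> ('v \<Rightarrow> 'v) \<Rightarrow> 'v \<Rightarrow> 'v"
  where "commutator X Y = (\<lambda>f. X (Y f) - Y (X f))"

lemma pairing_simps:
  "pairing (u + v) r = pairing u r + pairing v r"
  "pairing (u - v) r = pairing u r - pairing v r"
  "pairing (a *s u) r = a * pairing u r"
  "pairing u (r + s) = pairing u r + pairing u s"
  "pairing u 0 = 0"
  by (simp_all add: pairing_def algebra_simps sum.distrib sum_subtractf sum_distrib_left)

lemma clinear_commutator:
  fixes X Y :: "'v::complex_vector \<Rightarrow> 'v"
  shows "clinear X \<Longrightarrow> clinear Y \<Longrightarrow> clinear (commutator X Y)"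
  by (simp add: clinear_iff commutator_def cvec.scale_right_diff_distrib)

lemma D_op_commutator:
  "commutator (D_op u r) (D_op v s) = D_op (pairing u s *s v - pairing v r *s u) (r + s)"
proof (rule laurent_linear_eqI)
  show "clinear (commutator (D_op u r) (D_op v s))"
    by (intro clinear_commutator D_op_linear)
  show "clinear (D_op (pairing u s *s v - pairing v r *s u) (r + s))"
    by (rule D_op_linear)
  fix k
  have lin: "D_op u r (c *\<^sub>C f) = c *\<^sub>C D_op u r f" for u :: "complex ^ 'a" and r c f
    using D_op_linear[of u r] by (simp add: clinear_iff)
  show "commutator (D_op u r) (D_op v s) (monomial k) =
      D_op (pairing u s *s v - pairing v r *s u) (r + s) (monomial k)"
    by (simp add: commutator_def D_op_monomial lin pairing_simps scaleC_scaleC add_ac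
        algebra_simps flip: cvec.scale_left_diff_distrib)
qed

lemma S_alg_linear: "X \<in> S_alg \<Longrightarrow> clinear X"
  unfolding S_alg_def
proof (induction rule: cvec.span_induct)
  case base
  show ?case
    by (auto simp: cvec.subspace_def clinear_iff scaleC_fun_def scaleC_add_right add_ac
        scaleC_scaleC mult.commute)
next
  case (step X)
  then show ?case using D_op_linear by auto
qed

lemma S_alg_commutator:
  assumes "X \<in> S_alg" "Y \<in> S_alg"
  shows "commutator X Y \<in> S_alg"
proof -
  have lin: "X (f + g) = X f + X g" "X (c *\<^sub>C f) = c *\<^sub>C X f" "X 0 = 0"
    if "X \<in> S_alg" for X :: "'a laurent \<Rightarrow> 'a laurent" and c f g
    using S_alg_linear[OF that, unfolded clinear_iff, THEN conjunct1, rule_format, of 0 0]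
      S_alg_linear[OF that] by (auto simp: clinear_iff)
  have gen: "commutator (D_op u r) Y \<in> S_alg" if "pairing u r = 0" "Y \<in> S_alg"
    for u :: "complex ^ 'a" and r Y
    using that(2) unfolding S_alg_def
  proof (induction rule: cvec.span_induct_alt)
    case base
    have "commutator (D_op u r) 0 = 0"
      by (simp add: commutator_def fun_eq_iff D_op_zero)
    then show ?case by (simp only: cvec.span_zero)
  next
    case (step c Z Y)
    then obtain v s where Z: "Z = D_op v s" "pairing v s = 0" by auto
    have "commutator (D_op u r) (c *\<^sub>C Z + Y) = c *\<^sub>C commutator (D_op u r) Z + commutator (D_op u r) Y"
      using D_op_linear[of u r] unfolding clinear_iff
      by (simp add: commutator_def fun_eq_iff scaleC_fun_def cvec.scale_right_diff_distrib)
    moreover have *: "commutator (D_op u r) Z \<in> cspan {D_op u r | u r. pairing u r = 0}"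
      unfolding Z D_op_commutator
      by (rule cvec.span_base, rule CollectI, intro exI conjI, rule refl)
        (simp add: pairing_simps that(1) Z(2))
    ultimately show ?case
      using cvec.span_add[OF cvec.span_scale[OF *] step.IH] by (simp only:)
  qed
  show ?thesis
    using assms(1) unfolding S_alg_def
  proof (induction rule: cvec.span_induct_alt)
    case base
    have "commutator 0 Y = 0"
      using lin(3)[OF assms(2)] by (simp add: commutator_def fun_eq_iff)
    then show ?case by (simp only: cvec.span_zero)
  next
    case (step c Z X)
    have "commutator (c *\<^sub>C Z + X) Y = c *\<^sub>C commutator Z Y + commutator X Y"
      using lin[OF assms(2)]
      by (simp add: commutator_def fun_eq_iff scaleC_fun_def cvec.scale_right_diff_distrib)
    moreover have *: "commutator Z Y \<in> cspan {D_op u r | u r. pairing u r = 0}"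
      using step.hyps(1) gen[OF _ assms(2)] by (auto simp: S_alg_def)
    ultimately show ?case
      using cvec.span_add[OF cvec.span_scale[OF *] step.IH] by (simp only:)
  qed
qed

lemma S_alg_zero: "0 \<in> S_alg"
  and S_alg_add: "X \<in> S_alg \<Longrightarrow> Y \<in> S_alg \<Longrightarrow> X + Y \<in> S_alg"
  and S_alg_diff: "X \<in> S_alg \<Longrightarrow> Y \<in> S_alg \<Longrightarrow> X - Y \<in> S_alg"
  and S_alg_uminus: "X \<in> S_alg \<Longrightarrow> - X \<in> S_alg"
  and S_alg_scaleC: "X \<in> S_alg \<Longrightarrow> c *\<^sub>C X \<in> S_alg"
  by (auto simp: S_alg_def cvec.span_add cvec.span_diff cvec.span_neg
      cvec.span_scale cvec.span_zero)

text \<open>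
  The semidirect product: \<open>[(X, f), (Y, g)] = ([X, Y], X g - Y f)\<close>. Its defining relations on
  \<open>D(u, r)\<close> and \<open>t\<^sup>s\<close> are \<open>lie_sn_D\<close>, \<open>lie_sn_D_an_t\<close> and \<open>lie_an_t\<close> below.
\<close>

typedef 'n sn_an = "S_alg \<times> UNIV :: (('n::finite laurent \<Rightarrow> 'n laurent) \<times> 'n laurent) set"
  using S_alg_zero by auto

setup_lifting type_definition_sn_an

instantiation sn_an :: (finite) lie_algebra
begin

lift_definition zero_sn_an :: "'a sn_an" is 0
  by (simp add: zero_prod_def S_alg_zero)
lift_definition plus_sn_an :: "'a sn_an \<Rightarrow> 'a sn_an \<Rightarrow> 'a sn_an" is "(+)"
  by (auto simp: plus_prod_def S_alg_add)
lift_definition minus_sn_an :: "'a sn_an \<Rightarrow> 'a sn_an \<Rightarrow> 'a sn_an" is "(-)"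
  by (auto simp: minus_prod_def S_alg_diff)
lift_definition uminus_sn_an :: "'a sn_an \<Rightarrow> 'a sn_an" is uminus
  by (auto simp: uminus_prod_def S_alg_uminus)
lift_definition scaleC_sn_an :: "complex \<Rightarrow> 'a sn_an \<Rightarrow> 'a sn_an" is scaleC
  by (auto simp: scaleC_prod_def S_alg_scaleC)
lift_definition lie_sn_an :: "'a sn_an \<Rightarrow> 'a sn_an \<Rightarrow> 'a sn_an"
  is "\<lambda>(X, f) (Y, g). (commutator X Y, X g - Y f)"
  by (auto simp: S_alg_commutator)

instance
proof
  fix x y z :: "'a sn_an" and c c' :: complex
  have lin: "X (f + g) = X f + X g" "X (f - g) = X f - X g" "X (c *\<^sub>C f) = c *\<^sub>C X f"
    if "X \<in> S_alg" for X :: "'a laurent \<Rightarrow> 'a laurent" and c f g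
  proof -
    have *: "clinear X" by (rule S_alg_linear[OF that])
    then show "X (f + g) = X f + X g" "X (c *\<^sub>C f) = c *\<^sub>C X f" by (auto simp: clinear_iff)
    from * have "X (f - g + g) = X (f - g) + X g" unfolding clinear_iff by blast
    then show "X (f - g) = X f - X g" by (simp add: algebra_simps)
  qed
  show "x + y + z = x + (y + z)" "x + y = y + x" "0 + x = x" "- x + x = 0" "x - y = x + - y"
    by (transfer; simp add: algebra_simps)+
  show "c *\<^sub>C (x + y) = c *\<^sub>C x + c *\<^sub>C y" "(c + c') *\<^sub>C x = c *\<^sub>C x + c' *\<^sub>C x"
    "c *\<^sub>C c' *\<^sub>C x = (c * c') *\<^sub>C x" "1 *\<^sub>C x = x"
    by (transfer; simp add: scaleC_add_right scaleC_add_left scaleC_scaleC scaleC_one)+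
  obtain X f Y g Z h where rep: "Rep_sn_an x = (X, f)" "Rep_sn_an y = (Y, g)" "Rep_sn_an z = (Z, h)"
    by (meson surj_pair)
  have "X \<in> S_alg" "Y \<in> S_alg" "Z \<in> S_alg"
    using Rep_sn_an[of x] Rep_sn_an[of y] Rep_sn_an[of z] by (simp_all add: rep)
  note l = this[THEN lin(1)] this[THEN lin(2)] this[THEN lin(3)]
  note reps = lie_sn_an.rep_eq plus_sn_an.rep_eq zero_sn_an.rep_eq scaleC_sn_an.rep_eq
    rep zero_prod_def scaleC_prod_def
  show "lie (x + y) z = lie x z + lie y z" "lie x (y + z) = lie x y + lie x z"
    unfolding Rep_sn_an_inject[symmetric] by (simp_all add: reps commutator_def fun_eq_iff l)
  show "lie (c *\<^sub>C x) y = c *\<^sub>C lie x y" "lie x (c *\<^sub>C y) = c *\<^sub>C lie x y"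
    unfolding Rep_sn_an_inject[symmetric]
    by (simp_all add: reps commutator_def fun_eq_iff l scaleC_fun_def cvec.scale_right_diff_distrib)
  show "lie x x = 0"
    unfolding Rep_sn_an_inject[symmetric] by (simp add: reps commutator_def fun_eq_iff)
  have "commutator X (commutator Y Z) + commutator Y (commutator Z X)
      + commutator Z (commutator X Y) = 0"
    by (rule ext) (simp add: commutator_def l)
  moreover have "X (Y h - Z g) - commutator Y Z f + (Y (Z f - X h) - commutator Z X g)
      + (Z (X g - Y f) - commutator X Y h) = 0"
    by (simp add: commutator_def l)
  ultimately show "lie x (lie y z) + lie y (lie z x) + lie z (lie x y) = 0"
    unfolding Rep_sn_an_inject[symmetric] by (simp add: reps)
qed

end

text \<open>\<open>D(u, r)\<close> belongs to \<open>S\<^sub>N\<close> only if \<open>(u|r) = 0\<close>; \<open>sn_D u r\<close> is 0 otherwise.\<close>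

lift_definition sn_D :: "complex ^ 'n \<Rightarrow> int ^ 'n \<Rightarrow> 'n::finite sn_an"
  is "\<lambda>u r. if pairing u r = 0 then (D_op u r, 0) else 0"
  by (auto simp: S_alg_def zero_prod_def cvec.span_zero intro: cvec.span_base)

lift_definition an_t :: "int ^ 'n \<Rightarrow> 'n::finite sn_an"
  is "\<lambda>r. (0, monomial r)"
  by (simp add: S_alg_zero)

lemma lie_sn_D:
  assumes "pairing u r = 0" "pairing v s = 0"
  shows "lie (sn_D u r) (sn_D v s) = sn_D (pairing u s *s v - pairing v r *s u) (r + s)"
  using assms
  by transfer (simp add: D_op_commutator D_op_zero pairing_simps)

lemma lie_sn_D_an_t: "pairing u r = 0 \<Longrightarrow> lie (sn_D u r) (an_t s) = pairing u s *\<^sub>C an_t (r + s)"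
  by transfer (simp add: D_op_monomial D_op_zero commutator_def scaleC_prod_def fun_eq_iff)

lemma lie_an_t: "lie (an_t r) (an_t s) = 0"
  by transfer (simp add: commutator_def zero_prod_def fun_eq_iff)


section \<open>Modules\<close>

locale lie_module =
  fixes act :: "'l::lie_algebra \<Rightarrow> 'v::complex_vector \<Rightarrow> 'v"
  assumes linear_vec: "clinear (act x)"
    and linear_alg: "clinear (\<lambda>x. act x v)"
    and act_lie: "act (lie x y) v = act x (act y v) - act y (act x v)"

definition irreducible_module :: "('l::lie_algebra \<Rightarrow> 'v::complex_vector \<Rightarrow> 'v) \<Rightarrow> bool"
  where "irreducible_module act \<longleftrightarrow> (UNIV :: 'v set) \<noteq> {0} \<and>
    (\<forall>W. csubspace W \<and> (\<forall>x. \<forall>w\<in>W. act x w \<in> W) \<longrightarrow> W = {0} \<or> W = UNIV)"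

text \<open>\<open>d\<^sub>i = D(e\<^sub>i, 0)\<close>, and \<open>x\<close> stands for \<open>x \<otimes> 1\<close>.\<close>

definition cartan :: "('n::finite sn_an, 'b::complex_comm_algebra) tensor set"
  where "cartan = cspan (range (\<lambda>i. tens (sn_D (axis i 1) 0) 1))"

text \<open>Linear functionals on \<open>cartan\<close>; values elsewhere are irrelevant.\<close>

definition cartan_dual :: "(('n::finite sn_an, 'b::complex_comm_algebra) tensor \<Rightarrow> complex) set"
  where "cartan_dual = {wt. \<forall>h\<in>cartan. \<forall>k\<in>cartan. \<forall>c.
    wt (h + k) = wt h + wt k \<and> wt (c *\<^sub>C h) = c * wt h}"

definition weight_space ::
    "(('n::finite sn_an, 'b::complex_comm_algebra) tensor \<Rightarrow> 'v::complex_vector \<Rightarrow> 'v) \<Rightarrow>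
      (('n sn_an, 'b) tensor \<Rightarrow> complex) \<Rightarrow> 'v set"
  where "weight_space act wt = {v. \<forall>h\<in>cartan. act h v = wt h *\<^sub>C v}"

text \<open>
  The sum of the weight spaces for distinct functionals on \<open>cartan\<close> is automatically direct, so
  \<open>V = \<Oplus> V\<^sub>\<lambda>\<close> means that the weight spaces span \<open>V\<close>.
\<close>

definition weight_module ::
    "(('n::finite sn_an, 'b::complex_comm_algebra) tensor \<Rightarrow> 'v::complex_vector \<Rightarrow> 'v) \<Rightarrow> bool"
  where "weight_module act \<longleftrightarrow> cspan (\<Union>wt\<in>cartan_dual. weight_space act wt) = UNIV"

text \<open>
  \<open>vector_space.dim\<close> is 0 on infinite-dimensional spaces, so the bound on the dimension is
  expressed by a finite basis.
\<close>

definition uniformly_bounded ::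
    "(('n::finite sn_an, 'b::complex_comm_algebra) tensor \<Rightarrow> 'v::complex_vector \<Rightarrow> 'v) \<Rightarrow> bool"
  where "uniformly_bounded act \<longleftrightarrow> (\<exists>M>0. \<forall>wt\<in>cartan_dual.
    \<exists>S. finite S \<and> card S \<le> M \<and> \<not> cdependent S \<and> cspan S = weight_space act wt)"

definition is_ordered_basis :: "'v::complex_vector list \<Rightarrow> 'v set \<Rightarrow> bool"
  where "is_ordered_basis vs W \<longleftrightarrow>
    distinct vs \<and> \<not> cdependent (set vs) \<and> cspan (set vs) = W"

text \<open>
  The matrix \<open>\<^bold>B\<close> of \<open>t\<^sup>m b \<cdot> t\<^sup>n b'\<close> with respect to the ordered bases \<open>vs\<close> and
  \<open>map (act (t\<^sup>m\<^sup>+\<^sup>n)) vs\<close>; its \<open>j\<close>-th column holds the coordinates of the image of \<open>vs ! j\<close>.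
\<close>

definition B_mat ::
    "(('n::finite sn_an, 'b::complex_comm_algebra) tensor \<Rightarrow> 'v::complex_vector \<Rightarrow> 'v) \<Rightarrow>
      'v list \<Rightarrow> int ^ 'n \<Rightarrow> int ^ 'n \<Rightarrow> 'b \<Rightarrow> 'b \<Rightarrow> complex mat"
  where "B_mat act vs m n b b' =
    (THE B. B \<in> carrier_mat (length vs) (length vs) \<and>
      (\<forall>j<length vs. act (tens (an_t m) b) (act (tens (an_t n) b') (vs ! j)) =
        (\<Sum>i<length vs. B $$ (i, j) *\<^sub>C act (tens (an_t (m + n)) 1) (vs ! i))))"

end

theory Submission
  imports Defs
begin

text \<open>
  Let \<open>V\<close> be the module. All operators \<open>t\<^sup>r b\<close> on \<open>V\<close> commute; they lie in a commutative algebra of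
  operators (\<open>T_algebra\<close>, their double commutant) that is stable under bracketing with the operators
  \<open>D(u, r) b\<close>. Irreducibility gives a dichotomy: every element \<open>x\<close> of this algebra is injective or
  locally nilpotent, since its generalised kernel is a submodule (\<open>locally_nilpotent_or_inj\<close>).

  Granted that all \<open>t\<^sup>r\<close> are injective, the theorem follows. An eigenvector of the matrix yields a
  nonzero vector in the kernel of \<open>Q = t\<^sup>m b \<cdot> t\<^sup>n b' - \<mu> t\<^sup>m\<^sup>+\<^sup>n\<close>, so \<open>Q\<close> is locally nilpotent. Multiplied
  by \<open>t\<^sup>-\<^sup>m\<^sup>-\<^sup>n\<close> it preserves the finite-dimensional weight spaces, whose dimensions are bounded, so
  \<open>Q\<close> is nilpotent. Derivatives of nilpotents are nilpotent (\<open>derivation_nilpotent\<close>), so the vectors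
  killed by all homogeneous nilpotents form a submodule; it is nonzero because commuting nilpotents on
  a weight space have a common kernel. Hence it is \<open>V\<close>, and \<open>Q = 0\<close>
  (\<open>homogeneous_not_inj_imp_zero\<close>).

  The substance of the proof is the injectivity of \<open>t\<^sup>r\<close> for \<open>r \<noteq> 0\<close> (\<open>inj_T\<close>; \<open>t\<^sup>0\<close> is central), which rests on
  \<open>window_vanishing\<close>. Let \<open>v\<close> be a weight vector killed by \<open>t\<^sup>k\<^sup>a\<close> for small \<open>k \<noteq> 0\<close> and by
  \<open>t\<^sup>b\<^sup>-\<^sup>k\<^sup>a \<beta>\<close> for a window of values \<open>k > 0\<close>, where \<open>b\<close> is not collinear to \<open>a\<close>. Among \<open>M + 1\<close>
  suitable vectors \<open>D(u, q) \<beta> D(u', q') \<beta>' v\<close> of equal weight there is a linear relation, \<open>M\<close> being the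
  bound on the dimensions, and applying \<open>t\<^sup>i\<^sup>a t\<^sup>-\<^sup>i\<^sup>a\<close> to it gives \<open>t\<^sup>b \<beta> t\<^sup>b\<^sup>' \<beta>' v = 0\<close> for all \<open>b'\<close> not
  collinear to \<open>a\<close>. This has two consequences. First, the \<open>t\<^sup>r b\<close> with \<open>r \<noteq> 0\<close> are not all locally
  nilpotent (\<open>not_all_locally_nilpotent\<close>): a common kernel vector for the exponents in a box would be
  killed by all of them, and such vectors form a proper submodule. Second, an injective \<open>t\<^sup>b\<close> with
  \<open>b \<noteq> 0\<close> and a locally nilpotent \<open>t\<^sup>a\<close> with \<open>a \<noteq> 0\<close> cannot coexist. Otherwise no injective element
  has a degree \<open>k a\<close> with \<open>k \<noteq> 0\<close>, for it would make \<open>t\<^sup>a\<close> or \<open>t\<^sup>-\<^sup>a\<close> nilpotent, and with it all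
  \<open>t\<^sup>r \<beta>\<close> with \<open>r \<noteq> 0\<close>; so \<open>t\<^sup>k\<^sup>a\<close> and \<open>t\<^sup>b\<^sup>-\<^sup>k\<^sup>a\<close> are locally nilpotent for \<open>k \<noteq> 0\<close>, and on a common
  kernel vector \<open>v\<close> the vanishing \<open>t\<^sup>b t\<^sup>b v = 0\<close> contradicts injectivity.
\<close>

section \<open>Linear operators and locally nilpotent operators\<close>

lemma clinear_simps:
  fixes f :: "'a::complex_vector \<Rightarrow> 'c::complex_vector"
  assumes "clinear f"
  shows "f (x + y) = f x + f y" "f (c *\<^sub>C x) = c *\<^sub>C f x" "f 0 = 0" "f (- x) = - f x"
    "f (x - y) = f x - f y" "f (sum g I) = (\<Sum>i\<in>I. f (g i))"
proof -
  interpret Vector_Spaces.linear scaleC scaleC f by (rule assms)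
  show "f (x + y) = f x + f y" "f (c *\<^sub>C x) = c *\<^sub>C f x" "f 0 = 0" "f (- x) = - f x"
    "f (x - y) = f x - f y" "f (sum g I) = (\<Sum>i\<in>I. f (g i))"
    by (rule add scale zero neg diff sum)+
qed

lemma funpow_commute:
  assumes "\<And>v. f (g v) = g (f v)"
  shows "(f ^^ k) (g v) = g ((f ^^ k) v)"
  by (induction k) (simp_all add: assms)

lemma funpow_comp:
  assumes "\<And>v. f (g v) = g (f v)"
  shows "((\<lambda>v. f (g v)) ^^ k) v = (f ^^ k) ((g ^^ k) v)"
  by (induction k) (simp_all add: funpow_commute[of f g, OF assms])

lemma clinear_funpow: "clinear f \<Longrightarrow> clinear (f ^^ k)"
  for f :: "'a::complex_vector \<Rightarrow> 'a"
  by (induction k) (simp_all add: clinear_iff)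

lemma clinear_injI:
  assumes "clinear f" "\<And>v. f v = 0 \<Longrightarrow> v = 0"
  shows "inj f"
proof (rule injI)
  fix x y assume "f x = f y"
  then have "f (x - y) = 0" by (simp add: clinear_simps(5)[OF assms(1)])
  then have "x - y = 0" by (rule assms(2))
  then show "x = y" by simp
qed

text \<open>The exponent may depend on the vector.\<close>

definition locally_nilpotent :: "('v::complex_vector \<Rightarrow> 'v) \<Rightarrow> bool"
  where "locally_nilpotent f \<longleftrightarrow> (\<forall>v. \<exists>k. (f ^^ k) v = 0)"

lemma locally_nilpotent_funpow:
  assumes f: "clinear f" "locally_nilpotent f" and k: "0 < k"
  shows "locally_nilpotent (f ^^ k)"
  unfolding locally_nilpotent_def
proof
  fix v
  obtain l where l: "(f ^^ l) v = 0" using f(2) by (auto simp: locally_nilpotent_def)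
  have "k * l = (k * l - l) + l" using k by (simp add: Suc_leI)
  then have "(f ^^ (k * l)) v = (f ^^ (k * l - l)) ((f ^^ l) v)" by (metis comp_apply funpow_add)
  then have "((f ^^ k) ^^ l) v = 0"
    by (simp add: funpow_mult l clinear_simps[OF clinear_funpow[OF f(1)]])
  then show "\<exists>l. ((f ^^ k) ^^ l) v = 0" ..
qed

text \<open>
  Every family of \<open>M + 1\<close> vectors in \<open>W\<close> (repetitions allowed) is linearly dependent. This
  form of \<open>dim W \<le> M\<close> delivers linear relations directly and needs no choice of a basis.
\<close>

definition dim_at_most :: "nat \<Rightarrow> 'v::complex_vector set \<Rightarrow> bool"
  where "dim_at_most M W \<longleftrightarrow> (\<forall>w. (\<forall>j\<le>M. w j \<in> W) \<longrightarrow>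
    (\<exists>c. (\<exists>j\<le>M. c j \<noteq> 0) \<and> (\<Sum>j\<le>M. c j *\<^sub>C w j) = 0))"

lemma dim_at_most_span:
  assumes "finite S" "card S \<le> M"
  shows "dim_at_most M (cspan S)"
  unfolding dim_at_most_def
proof (intro allI impI)
  fix w :: "nat \<Rightarrow> 'a"
  assume w: "\<forall>j\<le>M. w j \<in> cspan S"
  show "\<exists>c. (\<exists>j\<le>M. c j \<noteq> 0) \<and> (\<Sum>j\<le>M. c j *\<^sub>C w j) = 0"
  proof (cases "inj_on w {..M}")
    case True
    have "cdependent (w ` {..M})"
    proof (rule ccontr)
      assume "\<not> cdependent (w ` {..M})"
      then have "card (w ` {..M}) \<le> card S"
        using cvec.independent_span_bound[OF assms(1)] w by blast
      then show False using assms(2) card_image[OF True] by simp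
    qed
    then obtain u where u: "\<exists>x\<in>w ` {..M}. u x \<noteq> 0" "(\<Sum>x\<in>w ` {..M}. u x *\<^sub>C x) = 0"
      using cvec.dependent_finite[of "w ` {..M}"] by auto
    show ?thesis
      using u by (intro exI[of _ "\<lambda>j. u (w j)"]) (auto simp: sum.reindex[OF True])
  next
    case False
    then obtain i j where ij: "i \<le> M" "j \<le> M" "i \<noteq> j" "w i = w j" by (auto simp: inj_on_def)
    define c :: "nat \<Rightarrow> complex" where "c k = (if k = i then 1 else if k = j then -1 else 0)" for k
    have "(\<Sum>k\<le>M. c k *\<^sub>C w k) = (\<Sum>k\<in>{i, j}. c k *\<^sub>C w k)"
      by (rule sum.mono_neutral_right) (use ij in \<open>auto simp: c_def\<close>)
    also have "\<dots> = 0" using ij by (simp add: c_def scaleC_one)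
    finally show ?thesis using ij by (intro exI[of _ c]) (auto simp: c_def)
  qed
qed

text \<open>A nontrivial relation, with the index of its first nonzero coefficient.\<close>

lemma dim_at_mostE:
  assumes "dim_at_most M W" "\<And>j. j \<le> M \<Longrightarrow> w j \<in> W"
  obtains c i where "i \<le> M" "c i \<noteq> 0" "\<And>j. j < i \<Longrightarrow> c j = 0" "(\<Sum>j\<le>M. c j *\<^sub>C w j) = 0"
proof -
  obtain c where c: "\<exists>j\<le>M. c j \<noteq> 0" "(\<Sum>j\<le>M. c j *\<^sub>C w j) = 0"
    using assms(1)[unfolded dim_at_most_def, THEN spec, THEN mp, of w] assms(2) by auto
  define i where "i = (LEAST j. j \<le> M \<and> c j \<noteq> 0)"
  have i: "i \<le> M \<and> c i \<noteq> 0" unfolding i_def by (rule LeastI_ex) (use c in auto)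
  have "c j = 0" if "j < i" for j
    using not_less_Least[of j "\<lambda>j. j \<le> M \<and> c j \<noteq> 0"] that i unfolding i_def[symmetric] by auto
  then show ?thesis using that i c(2) by blast
qed

text \<open>
  On a space of dimension at most \<open>M\<close> the exponent in local nilpotency can be taken to be \<open>M\<close>.
\<close>

lemma nilpotent_exponent:
  assumes W: "dim_at_most M W" "\<And>v. v \<in> W \<Longrightarrow> f v \<in> W" and f: "clinear f"
    and v: "v \<in> W" "(f ^^ k) v = 0"
  shows "(f ^^ M) v = 0"
proof (rule ccontr)
  assume nz: "(f ^^ M) v \<noteq> 0"
  define l where "l = (LEAST k. (f ^^ k) v = 0)"
  have l: "(f ^^ l) v = 0" unfolding l_def by (rule LeastI[of _ k]) (rule v(2))
  have l': "(f ^^ j) v \<noteq> 0" if "j < l" for j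
    using not_less_Least that unfolding l_def by blast
  have lin: "clinear (f ^^ j)" for j by (rule clinear_funpow[OF f])
  have up: "(f ^^ j) v = 0" if "l \<le> j" for j
  proof -
    have "(f ^^ j) v = (f ^^ (j - l)) ((f ^^ l) v)"
      using that by (simp flip: funpow_add[THEN fun_cong, unfolded comp_def])
    then show ?thesis by (simp add: l clinear_simps[OF lin])
  qed
  have "M < l" using up nz by (meson not_le)
  have mem: "(f ^^ j) v \<in> W" for j by (induction j) (use W v in auto)
  obtain c i where c: "i \<le> M" "c i \<noteq> 0" "\<And>j. j < i \<Longrightarrow> c j = 0"
      "(\<Sum>j\<le>M. c j *\<^sub>C (f ^^ j) v) = 0"
    by (rule dim_at_mostE[OF W(1), of "\<lambda>j. (f ^^ j) v"]) (rule mem, rule that)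
  \<comment> \<open>Applying \<open>f\<^sup>l\<^sup>-\<^sup>1\<^sup>-\<^sup>i\<close>, with \<open>l\<close> the exact exponent, leaves only the term of index \<open>i\<close>.\<close>
  have "0 = (f ^^ (l - 1 - i)) (\<Sum>j\<le>M. c j *\<^sub>C (f ^^ j) v)"
    by (simp add: c clinear_simps[OF lin])
  also have "\<dots> = (\<Sum>j\<le>M. c j *\<^sub>C (f ^^ (l - 1 - i + j)) v)"
    by (simp add: clinear_simps[OF lin] funpow_add)
  also have "\<dots> = (\<Sum>j\<in>{i}. c j *\<^sub>C (f ^^ (l - 1 - i + j)) v)"
  proof (rule sum.mono_neutral_right; (intro ballI)?)
    fix j assume "j \<in> {..M} - {i}"
    then consider "j < i" | "i < j" by fastforce
    then show "c j *\<^sub>C (f ^^ (l - 1 - i + j)) v = 0"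
      by cases (use c(3) up \<open>M < l\<close> c(1) in auto)
  qed (use c in auto)
  also have "\<dots> = c i *\<^sub>C (f ^^ (l - 1)) v" using c(1) \<open>M < l\<close> by simp
  finally show False using c(2) l'[of "l - 1"] \<open>M < l\<close> by simp
qed

lemma inj_imp_surj_on:
  assumes W: "dim_at_most M W" "\<And>v. v \<in> W \<Longrightarrow> f v \<in> W" "csubspace W"
    and f: "clinear f" "inj f" and v: "v \<in> W"
  shows "v \<in> f ` W"
proof -
  have lin: "clinear (f ^^ j)" for j by (rule clinear_funpow[OF f(1)])
  have mem: "(f ^^ j) v \<in> W" for j by (induction j) (use W v in auto)
  obtain c i where c: "i \<le> M" "c i \<noteq> 0" "\<And>j. j < i \<Longrightarrow> c j = 0"
      "(\<Sum>j\<le>M. c j *\<^sub>C (f ^^ j) v) = 0"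
    by (rule dim_at_mostE[OF W(1), of "\<lambda>j. (f ^^ j) v"]) (rule mem, rule that)
  \<comment> \<open>The relation reads \<open>f\<^sup>i (c\<^sub>i v + f u) = 0\<close>, and \<open>f\<^sup>i\<close> can be cancelled.\<close>
  define u where "u = (\<Sum>j\<in>{i<..M}. c j *\<^sub>C (f ^^ (j - Suc i)) v)"
  have u: "u \<in> W" unfolding u_def
    by (intro cvec.subspace_sum[OF W(3)] cvec.subspace_scale[OF W(3)] mem)
  have "(f ^^ i) (c i *\<^sub>C v + f u)
      = c i *\<^sub>C (f ^^ i) v + (\<Sum>j\<in>{i<..M}. c j *\<^sub>C (f ^^ i) (f ((f ^^ (j - Suc i)) v)))"
    by (simp add: u_def clinear_simps[OF lin] clinear_simps[OF f(1)])
  also have "(\<Sum>j\<in>{i<..M}. c j *\<^sub>C (f ^^ i) (f ((f ^^ (j - Suc i)) v)))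
      = (\<Sum>j\<in>{i<..M}. c j *\<^sub>C (f ^^ j) v)"
  proof (rule sum.cong[OF refl])
    fix j assume "j \<in> {i<..M}"
    then have "j = i + Suc (j - Suc i)" by auto
    then have "(f ^^ j) v = (f ^^ i) ((f ^^ Suc (j - Suc i)) v)"
      by (metis comp_apply funpow_add)
    then show "c j *\<^sub>C (f ^^ i) (f ((f ^^ (j - Suc i)) v)) = c j *\<^sub>C (f ^^ j) v" by simp
  qed
  also have "c i *\<^sub>C (f ^^ i) v + \<dots> = (\<Sum>j\<in>insert i {i<..M}. c j *\<^sub>C (f ^^ j) v)"
    by simp
  also have "\<dots> = (\<Sum>j\<le>M. c j *\<^sub>C (f ^^ j) v)"
  proof (rule sum.mono_neutral_left; (intro ballI)?)
    fix j assume "j \<in> {..M} - insert i {i<..M}"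
    then have "j < i" by auto
    then show "c j *\<^sub>C (f ^^ j) v = 0" using c(3) by simp
  qed (use c in auto)
  also have "\<dots> = (f ^^ i) 0" by (simp add: c clinear_simps[OF lin])
  finally have "c i *\<^sub>C v + f u = 0" using inj_fn[OF f(2), of i] by (simp only: inj_eq)
  then have "c i *\<^sub>C v = f (- u)" by (simp add: clinear_simps[OF f(1)] eq_neg_iff_add_eq_0)
  then have "v = f ((1 / c i) *\<^sub>C (- u))"
    using c(2) scaleC_scaleC[of "1 / c i" "c i" v]
    by (simp only: clinear_simps(2)[OF f(1)]) (simp add: scaleC_one)
  then show ?thesis using u W(3) by (metis cvec.subspace_neg cvec.subspace_scale imageI)
qed

lemma finite_spanning_subset:
  assumes "dim_at_most M W" "X \<subseteq> W"
  obtains Y where "finite Y" "Y \<subseteq> X" "X \<subseteq> cspan Y"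
proof -
  obtain Y where Y: "Y \<subseteq> X" "\<not> cdependent Y" "X \<subseteq> cspan Y"
    using cvec.maximal_independent_subset by blast
  have "finite Y"
  proof (rule ccontr)
    assume "infinite Y"
    then obtain Z where Z: "Z \<subseteq> Y" "finite Z" "card Z = Suc M"
      using infinite_arbitrarily_large by blast
    obtain w where "bij_betw w {0..<card Z} Z" using ex_bij_betw_nat_finite[OF Z(2)] by blast
    moreover have "{0..<Suc M} = {..M}" by auto
    ultimately have w: "bij_betw w {..M} Z" using Z(3) by simp
    have "\<forall>j\<le>M. w j \<in> W" using w Z(1) Y(1) assms(2) by (auto dest!: bij_betwE)
    then obtain c where c: "\<exists>j\<le>M. c j \<noteq> 0" "(\<Sum>j\<le>M. c j *\<^sub>C w j) = 0"
      using assms(1)[unfolded dim_at_most_def, THEN spec, THEN mp, of w] by auto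
    define u where "u = (\<lambda>x. c (inv_into {..M} w x))"
    have inv: "u (w j) = c j" if "j \<le> M" for j
      using w that by (simp add: u_def bij_betw_def)
    have "(\<Sum>x\<in>Z. u x *\<^sub>C x) = (\<Sum>j\<le>M. u (w j) *\<^sub>C w j)"
      by (rule sum.reindex_bij_betw[OF w, symmetric])
    also have "\<dots> = 0" using inv c(2) by simp
    finally have "(\<Sum>x\<in>Z. u x *\<^sub>C x) = 0" .
    moreover obtain j where "j \<le> M" "c j \<noteq> 0" using c(1) by blast
    moreover from this have "w j \<in> Z" "u (w j) \<noteq> 0" using w inv by (auto dest: bij_betwE)
    ultimately have "cdependent Z" unfolding cvec.dependent_finite[OF Z(2)] by blast
    then show False using Y(2) Z(1) cvec.dependent_mono by blast
  qed
  then show ?thesis using that Y by blast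
qed

section \<open>Double commutants and derivations\<close>

text \<open>The linear operators that commute with every element of \<open>S\<close>.\<close>

definition commutant :: "('v::complex_vector \<Rightarrow> 'v) set \<Rightarrow> ('v \<Rightarrow> 'v) set"
  where "commutant S = {g. clinear g \<and> (\<forall>f\<in>S. \<forall>v. f (g v) = g (f v))}"

abbreviation bicommutant :: "('v::complex_vector \<Rightarrow> 'v) set \<Rightarrow> ('v \<Rightarrow> 'v) set"
  where "bicommutant S \<equiv> commutant (commutant S)"

lemma commutantD:
  "g \<in> commutant S \<Longrightarrow> clinear g" "g \<in> commutant S \<Longrightarrow> f \<in> S \<Longrightarrow> f (g v) = g (f v)"
  by (auto simp: commutant_def)

lemma bicommutant_superset: "(\<And>f. f \<in> S \<Longrightarrow> clinear f) \<Longrightarrow> S \<subseteq> bicommutant S"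
  by (auto simp: commutant_def)

lemma commutant_comp: "f \<in> commutant S \<Longrightarrow> g \<in> commutant S \<Longrightarrow> (\<lambda>v. f (g v)) \<in> commutant S"
  by (auto simp: commutant_def clinear_iff)

lemma commutant_id: "(\<lambda>v. v) \<in> commutant S"
  by (auto simp: commutant_def clinear_iff)

lemma commutant_diff_scaleC:
  assumes "S \<subseteq> Collect clinear" "f \<in> commutant S" "g \<in> commutant S"
  shows "(\<lambda>v. f v - c *\<^sub>C g v) \<in> commutant S"
proof -
  have "clinear (\<lambda>v. f v - c *\<^sub>C g v)"
    using commutantD(1)[OF assms(2)] commutantD(1)[OF assms(3)]
    by (simp add: clinear_iff scaleC_add_right cvec.scale_right_diff_distrib scaleC_scaleC
        mult.commute)
  moreover have "h (f v - c *\<^sub>C g v) = f (h v) - c *\<^sub>C g (h v)" if "h \<in> S" for h v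
  proof -
    have "clinear h" using assms(1) that by auto
    then show ?thesis using commutantD(2)[OF _ that] assms(2,3) by (simp add: clinear_simps)
  qed
  ultimately show ?thesis by (auto simp: commutant_def)
qed

lemma bicommutant_commute:
  assumes S: "\<And>f. f \<in> S \<Longrightarrow> clinear f" "\<And>f g v. f \<in> S \<Longrightarrow> g \<in> S \<Longrightarrow> f (g v) = g (f v)"
    and "x \<in> bicommutant S" "y \<in> bicommutant S"
  shows "x (y v) = y (x v)"
proof -
  have "S \<subseteq> commutant S" using S by (auto simp: commutant_def)
  then have "y \<in> commutant S" using assms(4) by (auto simp: commutant_def)
  then show ?thesis using commutantD(2)[OF assms(3)] by metis
qed

text \<open>By the Jacobi identity \<open>[[X, y], f] = - [y, [X, f]]\<close> for \<open>y\<close> commuting with \<open>f\<close>.\<close>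

lemma commutator_mem_commutant:
  assumes S: "S \<subseteq> Collect clinear"
    and X: "clinear X" "\<And>f. f \<in> S \<Longrightarrow> commutator X f \<in> bicommutant S"
    and y: "y \<in> commutant S"
  shows "commutator X y \<in> commutant S"
proof -
  have lin: "clinear y" by (rule commutantD(1)[OF y])
  have "f (commutator X y v) = commutator X y (f v)" if "f \<in> S" for f v
  proof -
    have fy: "f (y w) = y (f w)" for w by (rule commutantD(2)[OF y that])
    have "commutator X f (y w) = y (commutator X f w)" for w
      using commutantD(2)[OF X(2)[OF that] y] by simp
    then have "X (f (y v)) - f (X (y v)) = y (X (f v)) - y (f (X v))"
      by (simp add: commutator_def clinear_simps[OF lin])
    then show ?thesis
      using S that by (auto simp: commutator_def clinear_simps fy algebra_simps)
  qed
  then show ?thesis using clinear_commutator[OF X(1) lin] by (auto simp: commutant_def)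
qed

text \<open>The double commutant is stable under every derivation \<open>[X, \<cdot>]\<close> that maps \<open>S\<close> into it.\<close>

lemma commutator_mem_bicommutant:
  assumes S: "S \<subseteq> Collect clinear"
    and X: "clinear X" "\<And>f. f \<in> S \<Longrightarrow> commutator X f \<in> bicommutant S"
    and x: "x \<in> bicommutant S"
  shows "commutator X x \<in> bicommutant S"
proof -
  have lin: "clinear x" by (rule commutantD(1)[OF x])
  have "f (commutator X x v) = commutator X x (f v)" if f: "f \<in> commutant S" for f v
  proof -
    have f_lin: "clinear f" by (rule commutantD(1)[OF f])
    have fx: "f (x w) = x (f w)" for w by (rule commutantD(2)[OF x f])
    have "commutator X f \<in> commutant S" by (rule commutator_mem_commutant[OF S X f])
    then have "commutator X f (x v) = x (commutator X f v)" by (rule commutantD(2)[OF x])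
    then show ?thesis
      by (simp add: commutator_def clinear_simps[OF lin] clinear_simps[OF f_lin] fx algebra_simps)
  qed
  then show ?thesis using clinear_commutator[OF X(1) lin] by (auto simp: commutant_def)
qed

text \<open>The generalised kernel of \<open>x\<close> is stable under \<open>X\<close> when \<open>[X, x]\<close> commutes with \<open>x\<close>.\<close>

lemma generalised_kernel_stable:
  assumes lin: "clinear x" "clinear X"
    and comm: "\<And>v. x (commutator X x v) = commutator X x (x v)"
  shows "(x ^^ k) v = 0 \<Longrightarrow> (x ^^ Suc k) (X v) = 0"
proof (induction k arbitrary: v)
  case 0
  then show ?case by (simp add: clinear_simps[OF lin(1)] clinear_simps[OF lin(2)])
next
  case (Suc k)
  define y where "y = commutator X x"
  have y_lin: "clinear y" unfolding y_def by (rule clinear_commutator[OF lin(2,1)])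
  have pow_lin: "clinear (x ^^ j)" for j by (rule clinear_funpow[OF lin(1)])
  have "(x ^^ k) (x v) = 0" using Suc.prems by (simp add: funpow_swap1)
  then have IH: "(x ^^ Suc k) (X (x v)) = 0" by (rule Suc.IH)
  have "(x ^^ Suc (Suc k)) (X v) = (x ^^ Suc k) (x (X v))" by (simp add: funpow_swap1)
  also have "x (X v) = X (x v) - y v" by (simp add: y_def commutator_def)
  also have "(x ^^ Suc k) (X (x v) - y v) = - (x ^^ Suc k) (y v)"
    by (simp only: clinear_simps(5)[OF pow_lin] IH) simp
  also have "(x ^^ Suc k) (y v) = y ((x ^^ Suc k) v)"
    by (rule funpow_commute) (simp add: y_def comm)
  also have "\<dots> = 0" using Suc.prems by (simp add: clinear_simps[OF y_lin])
  finally show ?case by simp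
qed

text \<open>\<open>[X, x\<^sup>m] = m x\<^sup>m\<^sup>-\<^sup>1 [X, x]\<close>, with the index shifted to avoid \<open>m - 1\<close>.\<close>

lemma derivation_funpow:
  assumes lin: "clinear x" "clinear X"
    and comm: "\<And>v. x (commutator X x v) = commutator X x (x v)"
  shows "X ((x ^^ Suc m) v) = (x ^^ Suc m) (X v) + of_nat (Suc m) *\<^sub>C (x ^^ m) (commutator X x v)"
proof (induction m arbitrary: v)
  case 0
  show ?case by (simp add: commutator_def scaleC_one)
next
  case (Suc m)
  define y where "y = commutator X x"
  have pow_lin: "clinear (x ^^ j)" for j by (rule clinear_funpow[OF lin(1)])
  have "X ((x ^^ Suc (Suc m)) v) = X ((x ^^ Suc m) (x v))" by (simp add: funpow_swap1)
  also have "\<dots> = (x ^^ Suc m) (X (x v)) + of_nat (Suc m) *\<^sub>C (x ^^ m) (y (x v))"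
    unfolding y_def by (rule Suc.IH)
  also have "X (x v) = x (X v) + y v" by (simp add: y_def commutator_def)
  also have "y (x v) = x (y v)" using comm by (simp add: y_def)
  also have "(x ^^ Suc m) (x (X v) + y v) + of_nat (Suc m) *\<^sub>C (x ^^ m) (x (y v))
      = (x ^^ Suc (Suc m)) (X v) + (1 + of_nat (Suc m)) *\<^sub>C (x ^^ Suc m) (y v)"
    by (simp only: clinear_simps(1)[OF pow_lin] clinear_simps(1)[OF lin(1)] funpow_Suc_right
        comp_apply scaleC_add_left scaleC_one add.assoc)
  finally show ?case by (simp only: y_def of_nat_Suc[of "Suc m"])
qed

text \<open>
  In characteristic zero the derivative \<open>y\<close> of a nilpotent element \<open>x\<close> of a commutative algebra is
  nilpotent: \<open>x\<^sup>k = 0\<close> implies \<open>x\<^sup>k\<^sup>-\<^sup>i y\<^sup>2\<^sup>i = 0\<close> by induction on \<open>i\<close>. Only the commutation of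
  \<open>x\<close>, \<open>y\<close> and the second derivative \<open>z\<close> is used.
\<close>

lemma derivation_nilpotent:
  assumes lin: "clinear x" "clinear X" and y: "y = commutator X x" and z: "z = commutator X y"
    and comm: "\<And>v. x (y v) = y (x v)" "\<And>v. x (z v) = z (x v)" "\<And>v. y (z v) = z (y v)"
    and nil: "\<And>v. (x ^^ k) v = 0"
  shows "(y ^^ (2 * k)) v = 0"
proof -
  have y_lin: "clinear y" unfolding y by (rule clinear_commutator[OF lin(2,1)])
  have z_lin: "clinear z" unfolding z by (rule clinear_commutator[OF lin(2) y_lin])
  have xp: "clinear (x ^^ j)" and yp: "clinear (y ^^ j)" for j
    by (rule clinear_funpow[OF lin(1)], rule clinear_funpow[OF y_lin])
  have "(x ^^ (k - i)) ((y ^^ (2 * i)) v) = 0" if "i \<le> k" for i v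
    using that
  proof (induction i arbitrary: v)
    case 0
    then show ?case by (simp add: nil)
  next
    case (Suc i)
    define m where "m = k - Suc i"
    have km: "k - i = Suc m" using Suc.prems by (simp add: m_def)
    have IH: "(x ^^ Suc m) ((y ^^ (2 * i)) v) = 0" for v using Suc by (simp add: km)
    \<comment> \<open>Differentiate \<open>x\<^sup>m\<^sup>+\<^sup>1 y\<^sup>2\<^sup>i = 0\<close> and multiply by \<open>y\<close>: the terms containing \<open>x\<^sup>m\<^sup>+\<^sup>1 y\<^sup>2\<^sup>i\<close> vanish, and
        \<open>(m + 1) x\<^sup>m y\<^sup>2\<^sup>i\<^sup>+\<^sup>2\<close> remains.\<close>
    have deriv_y: "y (X ((y ^^ (2 * i)) v)) = (y ^^ Suc (2 * i)) (X v)
        + of_nat (2 * i) *\<^sub>C (y ^^ (2 * i)) (z v)" for v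
    proof (cases i)
      case (Suc j)
      have "X ((y ^^ Suc (Suc (2 * j))) v) = (y ^^ Suc (Suc (2 * j))) (X v)
          + of_nat (Suc (Suc (2 * j))) *\<^sub>C (y ^^ Suc (2 * j)) (z v)"
        unfolding z by (rule derivation_funpow[OF y_lin lin(2)]) (use comm(3) z in simp)
      moreover have "2 * i = Suc (Suc (2 * j))" using Suc by simp
      ultimately show ?thesis
        by (simp add: clinear_simps[OF y_lin] del: of_nat_Suc)
    qed simp
    have xy: "(x ^^ j) (y v) = y ((x ^^ j) v)" for j v by (rule funpow_commute) (rule comm(1))
    have "0 = y (X ((x ^^ Suc m) ((y ^^ (2 * i)) v)))"
      by (simp only: IH clinear_simps(3)[OF lin(2)] clinear_simps(3)[OF y_lin])
    also have "X ((x ^^ Suc m) ((y ^^ (2 * i)) v)) = (x ^^ Suc m) (X ((y ^^ (2 * i)) v))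
        + of_nat (Suc m) *\<^sub>C (x ^^ m) (y ((y ^^ (2 * i)) v))"
      unfolding y by (rule derivation_funpow[OF lin]) (use comm(1) y in simp)
    also have "y \<dots> = (x ^^ Suc m) (y (X ((y ^^ (2 * i)) v)))
        + of_nat (Suc m) *\<^sub>C (x ^^ m) ((y ^^ Suc (Suc (2 * i))) v)"
      by (simp only: clinear_simps(1,2)[OF y_lin] xy funpow.simps(2)[of "2 * i"]
          funpow.simps(2)[of "Suc (2 * i)"] comp_apply)
    also have "(x ^^ Suc m) (y (X ((y ^^ (2 * i)) v))) = 0"
    proof -
      have "(x ^^ Suc m) ((y ^^ Suc (2 * i)) (X v)) = 0"
        using IH[of "X v"] by (simp only: funpow.simps(2)[of "2 * i"] comp_apply xy)
          (simp add: clinear_simps[OF y_lin])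
      then show ?thesis
        by (simp only: deriv_y clinear_simps(1,2)[OF xp] IH) simp
    qed
    finally have "of_nat (Suc m) *\<^sub>C (x ^^ m) ((y ^^ Suc (Suc (2 * i))) v) = 0" by simp
    then show ?case by (simp add: m_def del: of_nat_Suc)
  qed
  from this[of k v] show ?thesis by simp
qed

section \<open>Spanning sets and weights\<close>

text \<open>Exponents regarded as weights: \<open>t\<^sup>r\<close> and \<open>D(u, r)\<close> shift weights by \<open>cvec_of r\<close>.\<close>

definition cvec_of :: "int ^ 'n \<Rightarrow> complex ^ 'n"
  where "cvec_of r = (\<chi> i. of_int (vec_nth r i))"

lemma cvec_of_simps: "cvec_of (r + s) = cvec_of r + cvec_of s" "cvec_of 0 = 0"
  by (simp_all add: cvec_of_def Finite_Cartesian_Product.vec_eq_iff)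

lemma pairing_axis: "pairing (axis i 1) r = of_int (vec_nth r i)"
  unfolding pairing_def axis_def by (simp add: if_distrib[of "\<lambda>x. x * _"] cong: if_cong)

lemma D_op_scale: "D_op (c *s u) r = c *\<^sub>C D_op u r"
  by (simp add: D_op_def fun_eq_iff scaleC_fun_def cvec.scale_sum_right scaleC_scaleC)

lemma sn_D_scale: "pairing u r = 0 \<Longrightarrow> sn_D (c *s u) r = c *\<^sub>C sn_D u r"
  by transfer (simp add: pairing_simps D_op_scale scaleC_prod_def)

lemma lie_cartan_sn_D:
  assumes "pairing u r = 0"
  shows "lie (sn_D (axis i 1) 0) (sn_D u r) = of_int (vec_nth r i) *\<^sub>C sn_D u r"
  by (simp add: lie_sn_D assms pairing_simps pairing_axis sn_D_scale)

lemma lie_cartan_an_t: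
  "lie (sn_D (axis i 1) 0) (an_t r) = of_int (vec_nth r i) *\<^sub>C an_t r"
  by (simp add: lie_sn_D_an_t pairing_simps pairing_axis)

lemma tens_zero_left: "tens 0 b = 0"
  using tens_scaleC_left[of 0 0 b] by simp

text \<open>The elements \<open>D(u, r)\<close> with \<open>(u|r) = 0\<close> and \<open>t\<^sup>r\<close>, which span \<open>S\<^sub>N \<ltimes> A\<^sub>N\<close>.\<close>

definition sn_an_generators :: "'n::finite sn_an set"
  where "sn_an_generators = {sn_D u r | u r. pairing u r = 0} \<union> range an_t"

lemma span_sn_an_generators: "cspan sn_an_generators = (UNIV :: 'n::finite sn_an set)"
proof -
  have inj: "x = y" if "Rep_sn_an x = Rep_sn_an y" for x y :: "'n sn_an"
    using that by (simp add: Rep_sn_an_inject)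
  have S: "\<exists>x\<in>cspan sn_an_generators. Rep_sn_an x = (X, 0)"
    if "X \<in> S_alg" for X :: "'n laurent \<Rightarrow> 'n laurent"
    using that unfolding S_alg_def
  proof (induction rule: cvec.span_induct_alt)
    case base
    show ?case by (rule bexI[OF _ cvec.span_zero]) (simp add: zero_sn_an.rep_eq zero_prod_def zero_fun_def)
  next
    case (step c Y X)
    then obtain u r x where *: "Y = D_op u r" "pairing u r = 0" "x \<in> cspan sn_an_generators"
      "Rep_sn_an x = (X, 0)" by auto
    have "c *\<^sub>C sn_D u r + x \<in> cspan sn_an_generators"
      by (intro cvec.span_add cvec.span_scale cvec.span_base *)
        (use *(2) in \<open>auto simp: sn_an_generators_def\<close>)
    moreover have "Rep_sn_an (c *\<^sub>C sn_D u r + x) = (c *\<^sub>C Y + X, 0)"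
      using * by (simp add: plus_sn_an.rep_eq scaleC_sn_an.rep_eq sn_D.rep_eq scaleC_prod_def)
    ultimately show ?case by blast
  qed
  have A: "\<exists>x\<in>cspan sn_an_generators. Rep_sn_an x = (0, f)" for f :: "'n laurent"
  proof (induction f rule: poly_mapping_add_induct)
    case zero
    show ?case by (rule bexI[OF _ cvec.span_zero]) (simp add: zero_sn_an.rep_eq zero_prod_def zero_fun_def)
  next
    case (single k c)
    have "c *\<^sub>C an_t k \<in> cspan sn_an_generators"
      by (intro cvec.span_scale cvec.span_base) (simp add: sn_an_generators_def)
    moreover have "Rep_sn_an (c *\<^sub>C an_t k) = (0, Poly_Mapping.single k c)"
      by (simp add: scaleC_sn_an.rep_eq an_t.rep_eq scaleC_prod_def monomial_def flip: single_scaleC)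
    ultimately show ?case by blast
  next
    case (add p q)
    then obtain x y where "x \<in> cspan sn_an_generators" "y \<in> cspan sn_an_generators"
      "Rep_sn_an x = (0, p)" "Rep_sn_an y = (0, q)" by blast
    moreover from this have "Rep_sn_an (x + y) = (0, p + q)" by (simp add: plus_sn_an.rep_eq)
    ultimately show ?case using cvec.span_add by blast
  qed
  have "z \<in> cspan sn_an_generators" for z :: "'n sn_an"
  proof -
    obtain X f where z: "Rep_sn_an z = (X, f)" by fastforce
    then have "X \<in> S_alg" using Rep_sn_an[of z] by simp
    then obtain x y where xy: "x \<in> cspan sn_an_generators" "y \<in> cspan sn_an_generators"
      "Rep_sn_an x = (X, 0)" "Rep_sn_an y = (0, f)" using S A by blast
    then have "z = x + y" using z by (intro inj) (simp add: plus_sn_an.rep_eq)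
    then show ?thesis using xy by (simp add: cvec.span_add)
  qed
  then show ?thesis by blast
qed

text \<open>
  Simultaneous eigenspaces of the \<open>d\<^sub>i\<close>, indexed by the tuples of eigenvalues. They replace weight
  spaces because weights can then be added to exponents; the two notions are matched below.
\<close>

definition eigenspace ::
    "(('n::finite sn_an, 'b::complex_comm_algebra) tensor \<Rightarrow> 'v::complex_vector \<Rightarrow> 'v) \<Rightarrow>
      complex ^ 'n \<Rightarrow> 'v set"
  where "eigenspace act \<nu> = {v. \<forall>i. act (tens (sn_D (axis i 1) 0) 1) v = vec_nth \<nu> i *\<^sub>C v}"

context lie_module
begin

lemmas act_simps = clinear_simps[OF linear_vec]
lemmas act_alg_simps = clinear_simps[OF linear_alg]

end

lemma csubspace_eigenspace:
  assumes "lie_module act"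
  shows "csubspace (eigenspace act \<nu>)"
proof -
  interpret lie_module act by (rule assms)
  show ?thesis
    by (auto simp: cvec.subspace_def eigenspace_def act_simps scaleC_add_right scaleC_scaleC
        mult.commute)
qed

lemma weight_space_eq_eigenspace:
  fixes act :: "('n::finite sn_an, 'b::complex_comm_algebra) tensor \<Rightarrow> 'v::complex_vector \<Rightarrow> 'v"
  assumes act: "lie_module act" and wt: "wt \<in> cartan_dual"
  shows "weight_space act wt = eigenspace act (\<chi> i. wt (tens (sn_D (axis i 1) 0) 1))"
proof -
  interpret lie_module act by (rule act)
  let ?g = "\<lambda>i. tens (sn_D (axis i 1) 0) 1 :: ('n sn_an, 'b) tensor"
  have lin: "h \<in> cartan \<Longrightarrow> k \<in> cartan \<Longrightarrow> wt (h + k) = wt h + wt k"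
    "h \<in> cartan \<Longrightarrow> wt (c *\<^sub>C h) = c * wt h" for h k c
    using wt unfolding cartan_dual_def by blast+
  have gen: "?g i \<in> cartan" for i unfolding cartan_def by (rule cvec.span_base) simp
  have zero: "(0 :: ('n sn_an, 'b) tensor) \<in> cartan" unfolding cartan_def by (rule cvec.span_zero)
  have "act h v = wt h *\<^sub>C v" if v: "\<And>i. act (?g i) v = wt (?g i) *\<^sub>C v" and "h \<in> cartan" for v h
  proof -
    have "h \<in> cspan (range ?g)" using that(2) by (simp add: cartan_def)
    then have "h \<in> cartan \<and> act h v = wt h *\<^sub>C v"
    proof (induction rule: cvec.span_induct_alt)
      case base
      have "wt 0 = 0" using lin(2)[OF zero, of 0] by simp
      then show ?case by (simp add: act_alg_simps zero)
    next
      case (step c x y)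
      then obtain i where x: "x = ?g i" by blast
      have cx: "c *\<^sub>C x \<in> cartan" unfolding x cartan_def by (intro cvec.span_scale cvec.span_base) simp
      have "c *\<^sub>C x + y \<in> cartan"
        using cx step.IH unfolding cartan_def by (blast intro: cvec.span_add)
      then show ?case
        using step.IH lin(1)[OF cx, of y] lin(2)[OF gen[of i], of c] v[of i]
        by (simp add: act_alg_simps x scaleC_add_left scaleC_scaleC)
    qed
    then show ?thesis ..
  qed
  then show ?thesis using gen by (fastforce simp: weight_space_def eigenspace_def)
qed

text \<open>Conversely a nonzero simultaneous eigenspace is a weight space: the functional is read off
  from the action on a nonzero vector.\<close>

lemma eigenspace_eq_weight_space:
  fixes act :: "('n::finite sn_an, 'b::complex_comm_algebra) tensor \<Rightarrow> 'v::complex_vector \<Rightarrow> 'v"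
  assumes act: "lie_module act" and nz: "eigenspace act \<nu> \<noteq> {0}"
  obtains wt where "wt \<in> cartan_dual" "weight_space act wt = eigenspace act \<nu>"
proof -
  interpret lie_module act by (rule act)
  let ?g = "\<lambda>i. tens (sn_D (axis i 1) 0) 1 :: ('n sn_an, 'b) tensor"
  have "0 \<in> eigenspace act \<nu>" using csubspace_eigenspace[OF act] by (rule cvec.subspace_0)
  then obtain v where v: "v \<in> eigenspace act \<nu>" "v \<noteq> 0" using nz by blast
  have ex: "\<exists>c. act h v = c *\<^sub>C v" if "h \<in> cartan" for h
    using that unfolding cartan_def
  proof (induction rule: cvec.span_induct_alt)
    case base
    show ?case by (intro exI[of _ 0]) (simp add: act_alg_simps)
  next
    case (step c x y)
    then obtain i d where "x = ?g i" "act y v = d *\<^sub>C v" by blast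
    then have "act (c *\<^sub>C x + y) v = (c * vec_nth \<nu> i + d) *\<^sub>C v"
      using v(1) by (simp add: eigenspace_def act_alg_simps scaleC_add_left scaleC_scaleC)
    then show ?case ..
  qed
  define wt where "wt h = (SOME c. act h v = c *\<^sub>C v)" for h
  have wt: "act h v = wt h *\<^sub>C v" if "h \<in> cartan" for h
    unfolding wt_def using ex[OF that] by (rule someI_ex)
  have inj: "c = d" if "c *\<^sub>C v = d *\<^sub>C v" for c d
    using that v(2) by (simp add: cvec.scale_cancel_right)
  have closed: "h + k \<in> cartan" "c *\<^sub>C h \<in> cartan" if "h \<in> cartan" "k \<in> cartan"
    for h k :: "('n sn_an, 'b) tensor" and c
    using that by (auto simp: cartan_def cvec.span_add cvec.span_scale)
  have dual: "wt \<in> cartan_dual"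
    unfolding cartan_dual_def mem_Collect_eq
  proof (intro ballI allI conjI)
    fix h k :: "('n sn_an, 'b) tensor" and c assume hk: "h \<in> cartan" "k \<in> cartan"
    show "wt (h + k) = wt h + wt k"
      using wt[OF closed(1)[OF hk]] wt[OF hk(1)] wt[OF hk(2)]
      by (intro inj) (simp add: act_alg_simps scaleC_add_left)
    show "wt (c *\<^sub>C h) = c * wt h"
      using wt[OF closed(2)[OF hk, of c]] wt[OF hk(1)]
      by (intro inj) (simp only: act_alg_simps scaleC_scaleC[symmetric])
  qed
  have "wt (?g i) = vec_nth \<nu> i" for i
  proof (rule inj)
    have "?g i \<in> cartan" unfolding cartan_def by (rule cvec.span_base) simp
    then show "wt (?g i) *\<^sub>C v = vec_nth \<nu> i *\<^sub>C v" using wt[of "?g i"] v(1)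
      by (simp only: eigenspace_def mem_Collect_eq)
  qed
  then have "weight_space act wt = eigenspace act \<nu>"
    by (simp add: weight_space_eq_eigenspace[OF act dual] vec_nth_inverse)
  then show ?thesis using that dual by blast
qed

lemma eigenspace_dim_at_most:
  assumes "lie_module act" "uniformly_bounded act"
  obtains M where "\<And>\<nu>. dim_at_most M (eigenspace act \<nu>)"
proof -
  obtain M where M: "M > 0" "\<forall>wt\<in>cartan_dual.
    \<exists>S. finite S \<and> card S \<le> M \<and> \<not> cdependent S \<and> cspan S = weight_space act wt"
    using assms(2) unfolding uniformly_bounded_def by blast
  have "dim_at_most M (eigenspace act \<nu>)" for \<nu>
  proof (cases "eigenspace act \<nu> = {0}")
    case True
    then show ?thesis using dim_at_most_span[of "{}" M] by (simp add: cvec.span_empty)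
  next
    case False
    then obtain wt where "wt \<in> cartan_dual" "weight_space act wt = eigenspace act \<nu>"
      using eigenspace_eq_weight_space[OF assms(1)] by metis
    then show ?thesis using M(2) dim_at_most_span by metis
  qed
  then show ?thesis using that by blast
qed

lemma eigenspaces_span:
  assumes "lie_module act" "weight_module act"
  shows "cspan (\<Union>\<nu>. eigenspace act \<nu>) = UNIV"
proof -
  have "(\<Union>wt\<in>cartan_dual. weight_space act wt) \<subseteq> (\<Union>\<nu>. eigenspace act \<nu>)"
    using weight_space_eq_eigenspace[OF assms(1)] by blast
  then show ?thesis using cvec.span_mono assms(2) unfolding weight_module_def by blast
qed

section \<open>Bounded irreducible modules and the algebra of the operators \<open>t\<^sup>r b\<close>\<close>

text \<open>
  An irreducible module that is spanned by its simultaneous eigenspaces, all of dimension at most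
  \<open>M\<close>, for \<open>N \<ge> 2\<close> and with the two nontriviality conditions on \<open>A\<^sub>N\<close>.
\<close>

locale bounded_irreducible_module = lie_module act
  for act :: "('n::finite sn_an, 'b::complex_comm_algebra) tensor \<Rightarrow> 'v::complex_vector \<Rightarrow> 'v" +
  fixes M :: nat
  assumes irreducible: "irreducible_module act"
    and dim_at_most: "dim_at_most M (eigenspace act \<nu>)"
    and span_eigenspaces: "cspan (\<Union>\<nu>. eigenspace act \<nu>) = UNIV"
    and rank: "CARD('n) \<ge> 2"
    and T_zero_nontrivial: "\<exists>v. act (tens (an_t 0) 1) v \<noteq> 0"
    and T_nontrivial: "\<exists>r. r \<noteq> 0 \<and> (\<exists>v. act (tens (an_t r) 1) v \<noteq> 0)"
begin

abbreviation D :: "complex ^ 'n \<Rightarrow> int ^ 'n \<Rightarrow> 'b \<Rightarrow> 'v \<Rightarrow> 'v"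
  where "D u r b \<equiv> act (tens (sn_D u r) b)"

abbreviation T :: "int ^ 'n \<Rightarrow> 'b \<Rightarrow> 'v \<Rightarrow> 'v"
  where "T r b \<equiv> act (tens (an_t r) b)"

abbreviation W :: "complex ^ 'n \<Rightarrow> 'v set"
  where "W \<equiv> eigenspace act"

lemma D_T:
  assumes "pairing u r = 0"
  shows "D u r b (T s b' v) = T s b' (D u r b v) + pairing u s *\<^sub>C T (r + s) (b * b') v"
proof -
  have "act (lie (tens (sn_D u r) b) (tens (an_t s) b')) v = pairing u s *\<^sub>C T (r + s) (b * b') v"
    by (simp add: lie_tens lie_sn_D_an_t assms tens_scaleC_left act_alg_simps)
  then show ?thesis by (simp add: act_lie diff_eq_eq add.commute)
qed

lemma T_D:
  assumes "pairing u r = 0"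
  shows "T s b' (D u r b v) = D u r b (T s b' v) - pairing u s *\<^sub>C T (r + s) (b * b') v"
  using D_T[OF assms] by simp

lemma T_T: "T r b (T s b' v) = T s b' (T r b v)"
proof -
  have "act (lie (tens (an_t r) b) (tens (an_t s) b')) v = 0"
    by (simp add: lie_tens lie_an_t tens_zero_left act_alg_simps)
  then show ?thesis by (simp add: act_lie)
qed

lemma subspace_W: "csubspace (W \<nu>)"
  by (rule csubspace_eigenspace) (rule lie_module_axioms)

lemma shift_W:
  assumes x: "\<And>i. lie (sn_D (axis i 1) 0) x = of_int (vec_nth r i) *\<^sub>C x" and v: "v \<in> W \<nu>"
  shows "act (tens x b) v \<in> W (\<nu> + cvec_of r)"
proof -
  have "act (tens (sn_D (axis i 1) 0) 1) (act (tens x b) v)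
      = act (tens x b) (act (tens (sn_D (axis i 1) 0) 1) v) + of_int (vec_nth r i) *\<^sub>C act (tens x b) v"
    for i
    using act_lie[of "tens (sn_D (axis i 1) 0) 1" "tens x b" v]
    by (simp add: lie_tens x tens_scaleC_left act_alg_simps diff_eq_eq add.commute)
  then show ?thesis
    using v by (simp add: eigenspace_def cvec_of_def scaleC_add_left act_simps)
qed

lemma D_W: "v \<in> W \<nu> \<Longrightarrow> pairing u r = 0 \<Longrightarrow> D u r b v \<in> W (\<nu> + cvec_of r)"
  by (rule shift_W[OF lie_cartan_sn_D])

lemma T_W: "v \<in> W \<nu> \<Longrightarrow> T r b v \<in> W (\<nu> + cvec_of r)"
  by (rule shift_W[OF lie_cartan_an_t])

lemma submodule_trivial:
  assumes U: "csubspace U"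
    and D: "\<And>u r b v. pairing u r = 0 \<Longrightarrow> v \<in> U \<Longrightarrow> D u r b v \<in> U"
    and T: "\<And>r b v. v \<in> U \<Longrightarrow> T r b v \<in> U"
  shows "U = {0} \<or> U = UNIV"
proof -
  have gen: "act (tens x b) v \<in> U" if v: "v \<in> U" for x b v
  proof -
    have "x \<in> cspan sn_an_generators" by (simp add: span_sn_an_generators)
    then show ?thesis
    proof (induction rule: cvec.span_induct_alt)
      case base
      show ?case using U by (simp add: tens_zero_left act_alg_simps cvec.subspace_0)
    next
      case (step c x y)
      then have "act (tens x b) v \<in> U" using D T v by (auto simp: sn_an_generators_def)
      then show ?case
        using step.IH U
        by (simp add: tens_add_left tens_scaleC_left act_alg_simps cvec.subspace_add cvec.subspace_scale)
    qed
  qed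
  have "act x v \<in> U" if "v \<in> U" for x v
    by (induction x rule: tensor_induct)
      (use U that gen in \<open>auto simp: act_alg_simps cvec.subspace_0 cvec.subspace_add\<close>)
  then show ?thesis using irreducible U unfolding irreducible_module_def by blast
qed

lemma nontrivial: "(UNIV :: 'v set) \<noteq> {0}"
  using irreducible unfolding irreducible_module_def by blast

lemma eq_zero_from_weights:
  assumes f: "clinear f" and "\<And>\<nu> v. v \<in> W \<nu> \<Longrightarrow> f v = 0"
  shows "f v = 0"
proof -
  have "v \<in> cspan (\<Union>\<nu>. W \<nu>)" by (simp add: span_eigenspaces)
  then show ?thesis
    by (induction rule: cvec.span_induct_alt) (use assms in \<open>auto simp: clinear_simps[OF f]\<close>)
qed

lemma exists_nonzero_weight_vector:
  obtains \<nu> v where "v \<in> W \<nu>" "v \<noteq> 0"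
proof -
  obtain z :: 'v where "z \<noteq> 0" using nontrivial by blast
  moreover have "clinear (\<lambda>v :: 'v. v)" by (simp add: clinear_iff)
  ultimately show ?thesis using eq_zero_from_weights[of "\<lambda>v. v" z] that by blast
qed

text \<open>
  The algebra generated by the operators \<open>t\<^sup>r b\<close> is enlarged to their double commutant; this is
  still commutative and stable under the derivations \<open>[D(u, r) b, \<cdot>]\<close>, and membership needs no
  bookkeeping of words in the generators.
\<close>

definition T_algebra :: "('v \<Rightarrow> 'v) set"
  where "T_algebra = bicommutant {T r b | r b. True}"

text \<open>The elements of this algebra that shift weights by \<open>d\<close>.\<close>

definition homogeneous :: "int ^ 'n \<Rightarrow> ('v \<Rightarrow> 'v) set"
  where "homogeneous d = {x \<in> T_algebra. \<forall>\<nu>. \<forall>v\<in>W \<nu>. x v \<in> W (\<nu> + cvec_of d)}"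

lemma T_algebra_linear: "x \<in> T_algebra \<Longrightarrow> clinear x"
  unfolding T_algebra_def by (rule commutantD(1))

lemma T_algebra_commute: "x \<in> T_algebra \<Longrightarrow> y \<in> T_algebra \<Longrightarrow> x (y v) = y (x v)"
  unfolding T_algebra_def
  by (rule bicommutant_commute[where S = "{T r b | r b. True}"]) (auto simp: linear_vec T_T)

lemma T_mem: "T r b \<in> T_algebra"
  unfolding T_algebra_def
  using bicommutant_superset[of "{T r b | r b. True}"] linear_vec by blast

lemma T_algebra_comp: "x \<in> T_algebra \<Longrightarrow> y \<in> T_algebra \<Longrightarrow> (\<lambda>v. x (y v)) \<in> T_algebra"
  unfolding T_algebra_def by (rule commutant_comp)

lemma T_algebra_diff_scaleC:
  "x \<in> T_algebra \<Longrightarrow> y \<in> T_algebra \<Longrightarrow> (\<lambda>v. x v - c *\<^sub>C y v) \<in> T_algebra"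
  unfolding T_algebra_def by (rule commutant_diff_scaleC) (auto simp: commutant_def)

lemma commutator_D_T:
  assumes "pairing u r = 0"
  shows "commutator (D u r b) (T s b') = (\<lambda>v. pairing u s *\<^sub>C T (r + s) (b * b') v)"
  by (simp add: commutator_def D_T assms)

lemma commutator_D_mem:
  assumes "pairing u r = 0" "x \<in> T_algebra"
  shows "commutator (D u r b) x \<in> T_algebra"
  unfolding T_algebra_def
proof (rule commutator_mem_bicommutant)
  show "x \<in> bicommutant {T r b | r b. True}" using assms(2) by (simp add: T_algebra_def)
  fix f assume "f \<in> {T r b | r b. True}"
  then obtain s b' where f: "f = T s b'" by blast
  have "act (pairing u s *\<^sub>C tens (an_t (r + s)) (b * b')) = commutator (D u r b) f"
    by (simp add: f commutator_D_T assms fun_eq_iff act_alg_simps)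
  moreover have "pairing u s *\<^sub>C tens (an_t (r + s)) (b * b')
      = tens (an_t (r + s)) (pairing u s *\<^sub>C (b * b'))"
    by (simp add: tens_scaleC_right)
  ultimately have "commutator (D u r b) f = T (r + s) (pairing u s *\<^sub>C (b * b'))" by simp
  then show "commutator (D u r b) f \<in> bicommutant {T r b | r b. True}"
    using T_mem[of "r + s" "pairing u s *\<^sub>C (b * b')"] by (simp add: T_algebra_def)
qed (auto simp: linear_vec)

lemma homogeneousD:
  assumes "x \<in> homogeneous d"
  shows "x \<in> T_algebra" "v \<in> W \<nu> \<Longrightarrow> x v \<in> W (\<nu> + cvec_of d)"
  using assms by (auto simp: homogeneous_def)

lemma T_homogeneous: "T r b \<in> homogeneous r"
  by (simp add: homogeneous_def T_mem T_W)

lemma id_homogeneous: "(\<lambda>v. v) \<in> homogeneous 0"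
  by (simp add: homogeneous_def T_algebra_def commutant_id cvec_of_simps)

lemma homogeneous_comp:
  assumes "x \<in> homogeneous d" "y \<in> homogeneous e"
  shows "(\<lambda>v. x (y v)) \<in> homogeneous (d + e)"
proof -
  have "x (y v) \<in> W (\<nu> + cvec_of (d + e))" if "v \<in> W \<nu>" for v \<nu>
    using homogeneousD(2)[OF assms(1) homogeneousD(2)[OF assms(2) that]]
    by (simp add: cvec_of_simps add_ac)
  then show ?thesis
    using assms by (simp add: homogeneous_def T_algebra_comp)
qed

lemma homogeneous_funpow:
  assumes "x \<in> homogeneous d"
  shows "x ^^ k \<in> homogeneous (int k *s d)"
proof (induction k)
  case 0
  have "(0::int) *s d = 0" by (simp add: Finite_Cartesian_Product.vec_eq_iff)
  then show ?case using id_homogeneous by (simp add: id_def)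
next
  case (Suc k)
  have "int (Suc k) *s d = d + int k *s d"
    by (simp add: Finite_Cartesian_Product.vec_eq_iff distrib_right)
  then show ?case using homogeneous_comp[OF assms Suc] by (simp add: comp_def)
qed

lemma homogeneous_diff_scaleC:
  assumes "x \<in> homogeneous d" "y \<in> homogeneous d"
  shows "(\<lambda>v. x v - c *\<^sub>C y v) \<in> homogeneous d"
  using assms subspace_W
  by (auto simp: homogeneous_def T_algebra_diff_scaleC intro!: cvec.subspace_diff cvec.subspace_scale)

lemma homogeneous_commutator_D:
  assumes "pairing u r = 0" "x \<in> homogeneous d"
  shows "commutator (D u r b) x \<in> homogeneous (r + d)"
proof -
  have "D u r b (x v) - x (D u r b v) \<in> W (\<nu> + cvec_of (r + d))" if "v \<in> W \<nu>" for v \<nu>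
  proof (rule cvec.subspace_diff[OF subspace_W])
    show "D u r b (x v) \<in> W (\<nu> + cvec_of (r + d))"
      using D_W[OF homogeneousD(2)[OF assms(2) that] assms(1)] by (simp add: cvec_of_simps add_ac)
    show "x (D u r b v) \<in> W (\<nu> + cvec_of (r + d))"
      using homogeneousD(2)[OF assms(2) D_W[OF that assms(1)]] by (simp add: cvec_of_simps add_ac)
  qed
  then show ?thesis
    using assms by (simp add: homogeneous_def commutator_D_mem) (simp add: commutator_def)
qed

text \<open>
  The generalised kernel of an element \<open>x\<close> of the algebra is a submodule, because \<open>[D(u, r) b, x]\<close>
  lies in the algebra and so commutes with \<open>x\<close>. By irreducibility it is 0 or everything.
\<close>

lemma locally_nilpotent_or_inj:
  assumes x: "x \<in> T_algebra"
  shows "locally_nilpotent x \<or> inj x"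
proof -
  define U where "U = {v. \<exists>k. (x ^^ k) v = 0}"
  have lin: "clinear x" by (rule T_algebra_linear[OF x])
  have pow_lin: "clinear (x ^^ k)" for k by (rule clinear_funpow[OF lin])
  have up: "(x ^^ l) v = 0" if "(x ^^ k) v = 0" "k \<le> l" for k l v
  proof -
    have "(x ^^ l) v = (x ^^ (l - k)) ((x ^^ k) v)"
      using that(2) by (simp flip: funpow_add[THEN fun_cong, unfolded comp_def])
    then show ?thesis by (simp add: that clinear_simps[OF pow_lin])
  qed
  have "csubspace U"
    unfolding cvec.subspace_def
  proof (intro conjI ballI allI)
    show "0 \<in> U" by (auto simp: U_def clinear_simps[OF pow_lin])
    fix v assume "v \<in> U"
    then show "c *\<^sub>C v \<in> U" for c by (auto simp: U_def clinear_simps[OF pow_lin])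
    fix w assume "w \<in> U"
    with \<open>v \<in> U\<close> obtain k l where "(x ^^ k) v = 0" "(x ^^ l) w = 0" by (auto simp: U_def)
    then have "(x ^^ max k l) (v + w) = 0" using up by (simp add: clinear_simps[OF pow_lin])
    then show "v + w \<in> U" by (auto simp: U_def)
  qed
  moreover have "D u r b v \<in> U" if "pairing u r = 0" "v \<in> U" for u r b v
  proof -
    obtain k where "(x ^^ k) v = 0" using \<open>v \<in> U\<close> by (auto simp: U_def)
    then have "(x ^^ Suc k) (D u r b v) = 0"
      using generalised_kernel_stable[OF lin linear_vec]
        T_algebra_commute[OF x commutator_D_mem[OF that(1) x]] by blast
    then show ?thesis unfolding U_def by blast
  qed
  moreover have "T r b v \<in> U" if "v \<in> U" for r b v
  proof -
    obtain k where "(x ^^ k) v = 0" using \<open>v \<in> U\<close> by (auto simp: U_def)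
    moreover have "(x ^^ k) (T r b v) = T r b ((x ^^ k) v)"
      by (rule funpow_commute) (rule T_algebra_commute[OF x T_mem])
    ultimately show ?thesis by (auto simp: U_def act_simps)
  qed
  ultimately have "U = {0} \<or> U = UNIV" by (rule submodule_trivial)
  then show ?thesis
  proof
    assume U: "U = {0}"
    have "inj x"
    proof (rule clinear_injI[OF lin])
      fix v assume "x v = 0"
      then have "(x ^^ 1) v = 0" by simp
      then show "v = 0" using U unfolding U_def by blast
    qed
    then show ?thesis ..
  qed (auto simp: U_def locally_nilpotent_def)
qed

lemma not_inj_and_locally_nilpotent: "inj x \<Longrightarrow> locally_nilpotent x \<Longrightarrow> clinear x \<Longrightarrow> False"
  for x :: "'v \<Rightarrow> 'v"
proof -
  assume x: "inj x" "locally_nilpotent x" "clinear x"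
  have "v = 0" for v :: 'v
  proof -
    obtain k where "(x ^^ k) v = 0" using x(2) by (auto simp: locally_nilpotent_def)
    then have "(x ^^ k) v = (x ^^ k) 0" by (simp add: clinear_simps[OF clinear_funpow[OF x(3)]])
    then show ?thesis using inj_fn[OF x(1), of k] by (simp add: inj_eq)
  qed
  then show False using nontrivial by auto
qed

text \<open>
  Local nilpotency improves to nilpotency when the degree can be compensated by an injective
  element, because the product then preserves the spaces \<open>W \<nu>\<close> of dimension at most \<open>M\<close>.
\<close>

lemma nilpotent_if_compensated:
  assumes x: "x \<in> homogeneous d" "locally_nilpotent x" and y: "y \<in> homogeneous (- d)" "inj y"
  shows "(x ^^ M) v = 0"
proof (rule eq_zero_from_weights[of "x ^^ M"])
  have xA: "x \<in> T_algebra" and yA: "y \<in> T_algebra" using x y by (auto dest: homogeneousD)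
  show x_lin: "clinear (x ^^ M)" by (rule clinear_funpow[OF T_algebra_linear[OF xA]])
  fix \<nu> v assume v: "v \<in> W \<nu>"
  have comm: "y (x w) = x (y w)" for w by (rule T_algebra_commute[OF yA xA])
  let ?z = "\<lambda>v. y (x v)"
  have z: "?z \<in> homogeneous 0" using homogeneous_comp[OF y(1) x(1)] by simp
  have y_lin: "clinear (y ^^ k)" for k by (rule clinear_funpow[OF T_algebra_linear[OF yA]])
  obtain k where "(x ^^ k) v = 0" using x(2) by (auto simp: locally_nilpotent_def)
  then have k: "(?z ^^ k) v = 0" by (simp add: funpow_comp[of y x, OF comm] clinear_simps[OF y_lin])
  have "(?z ^^ M) v = 0"
    by (rule nilpotent_exponent[OF dim_at_most _ T_algebra_linear[OF homogeneousD(1)[OF z]] v k])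
      (use homogeneousD(2)[OF z] in \<open>simp add: cvec_of_simps\<close>)
  then have "(y ^^ M) ((x ^^ M) v) = (y ^^ M) 0"
    by (simp add: funpow_comp[of y x, OF comm] clinear_simps[OF y_lin])
  then show "(x ^^ M) v = 0" using inj_fn[OF y(2), of M] by (simp only: inj_eq)
qed

lemma locally_nilpotent_if_nilpotent: "(\<And>v. (x ^^ k) v = 0) \<Longrightarrow> locally_nilpotent x"
  unfolding locally_nilpotent_def by blast

text \<open>
  Commuting locally nilpotent operators have common kernel vectors: multiply \<open>v\<close> by as high powers
  as possible. A family of a single degree may be infinite, since on multiples of \<open>v\<close> it
  acts through the finite-dimensional space of its values at \<open>v\<close>.
\<close>

lemma finite_common_kernel:
  assumes "finite F" "\<And>x. x \<in> F \<Longrightarrow> x \<in> homogeneous (deg x) \<and> locally_nilpotent x" "v \<noteq> 0"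
  shows "\<exists>e. \<exists>y\<in>homogeneous e. y v \<noteq> 0 \<and> (\<forall>x\<in>F. x (y v) = 0)"
  using assms(1,2)
proof (induction F rule: finite_induct)
  case empty
  show ?case by (rule exI, rule bexI[OF _ id_homogeneous]) (use assms(3) in auto)
next
  case (insert x F)
  have "\<exists>e. \<exists>y\<in>homogeneous e. y v \<noteq> 0 \<and> (\<forall>x\<in>F. x (y v) = 0)"
    by (rule insert.IH) (use insert.prems in auto)
  then obtain e y where y: "y \<in> homogeneous e" "y v \<noteq> 0" "\<forall>x\<in>F. x (y v) = 0" by blast
  have x: "x \<in> homogeneous (deg x)" "locally_nilpotent x" using insert.prems by auto
  define k where "k = (LEAST k. (x ^^ k) (y v) = 0)"
  have k0: "(x ^^ k) (y v) = 0"
    unfolding k_def by (rule LeastI_ex) (use x(2) in \<open>auto simp: locally_nilpotent_def\<close>)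
  then obtain l where l: "k = Suc l" using y(2) by (cases k) auto
  have nz: "(x ^^ l) (y v) \<noteq> 0" using not_less_Least[of l "\<lambda>k. (x ^^ k) (y v) = 0"] l k_def by auto
  have h: "(\<lambda>w. (x ^^ l) (y w)) \<in> homogeneous (int l *s deg x + e)"
    by (rule homogeneous_comp[OF homogeneous_funpow[OF x(1)] y(1)])
  have "z ((x ^^ l) (y v)) = 0" if "z \<in> insert x F" for z
  proof (cases "z = x")
    case True
    then show ?thesis using k0 l by simp
  next
    case False
    then have z: "z \<in> F" using that by simp
    then have "z \<in> homogeneous (deg z)" using insert.prems by auto
    then have "z ((x ^^ l) (y v)) = (x ^^ l) (z (y v))"
      by (intro T_algebra_commute homogeneousD(1)[OF homogeneous_funpow[OF x(1)]] homogeneousD(1))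
    also have "z (y v) = 0" using z y(3) by blast
    also have "(x ^^ l) 0 = 0"
      by (rule clinear_simps(3)[OF clinear_funpow[OF T_algebra_linear[OF homogeneousD(1)[OF x(1)]]]])
    finally show ?thesis .
  qed
  note kernel = this
  show ?case by (rule exI, rule bexI[OF _ h]) (use kernel nz in auto)
qed

lemma family_common_kernel:
  assumes F: "\<And>x. x \<in> F \<Longrightarrow> x \<in> homogeneous d \<and> locally_nilpotent x"
    and v: "v \<in> W \<nu>" "v \<noteq> 0"
  shows "\<exists>e. \<exists>y\<in>homogeneous e. y v \<noteq> 0 \<and> (\<forall>x\<in>F. x (y v) = 0)"
proof -
  have "(\<lambda>x. x v) ` F \<subseteq> W (\<nu> + cvec_of d)" using F v homogeneousD(2) by blast
  then obtain Y where Y: "finite Y" "Y \<subseteq> (\<lambda>x. x v) ` F" "(\<lambda>x. x v) ` F \<subseteq> cspan Y"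
    by (rule finite_spanning_subset[OF dim_at_most])
  obtain G where G: "finite G" "G \<subseteq> F" "Y = (\<lambda>x. x v) ` G"
    using finite_subset_image[OF Y(1,2)] by blast
  have "\<exists>e. \<exists>y\<in>homogeneous e. y v \<noteq> 0 \<and> (\<forall>x\<in>G. x (y v) = 0)"
    by (rule finite_common_kernel[where deg = "\<lambda>_. d"]) (use F G v(2) in auto)
  then obtain e y where y: "y \<in> homogeneous e" "y v \<noteq> 0" "\<forall>x\<in>G. x (y v) = 0" by blast
  have yA: "y \<in> T_algebra" by (rule homogeneousD(1)[OF y(1)])
  have y_lin: "clinear y" by (rule T_algebra_linear[OF yA])
  have "y w = 0" if "w \<in> cspan Y" for w
    using that
  proof (induction rule: cvec.span_induct_alt)
    case (step c w z)
    then obtain x where "x \<in> G" "w = x v" using G(3) by blast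
    then have "x \<in> T_algebra" using F G(2) homogeneousD(1) by blast
    then have "y w = x (y v)" using T_algebra_commute[OF yA] \<open>w = x v\<close> by simp
    then have "y w = 0" using y(3) \<open>x \<in> G\<close> by simp
    then show ?case using step by (simp add: clinear_simps[OF y_lin])
  qed (simp add: clinear_simps[OF y_lin])
  moreover have "x v \<in> cspan Y" if "x \<in> F" for x using that Y(3) by blast
  moreover have "x (y v) = y (x v)" if "x \<in> F" for x
    using T_algebra_commute[OF _ yA] F[OF that] homogeneousD(1) by blast
  ultimately have "x (y v) = 0" if "x \<in> F" for x using that by simp
  note kernel = this
  show ?thesis by (rule exI, rule bexI[OF _ y(1)]) (use kernel y in auto)
qed

lemma finite_families_common_kernel:
  assumes "finite I" "\<And>i x. i \<in> I \<Longrightarrow> x \<in> F i \<Longrightarrow> x \<in> homogeneous (deg i) \<and> locally_nilpotent x"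
    and v: "v \<in> W \<nu>" "v \<noteq> 0"
  obtains e y where "y \<in> homogeneous e" "y v \<noteq> 0" "\<And>i x. i \<in> I \<Longrightarrow> x \<in> F i \<Longrightarrow> x (y v) = 0"
proof -
  have "\<exists>e. \<exists>y\<in>homogeneous e. y v \<noteq> 0 \<and> (\<forall>i\<in>I. \<forall>x\<in>F i. x (y v) = 0)"
    using assms(1,2)
  proof (induction I rule: finite_induct)
    case empty
    show ?case by (rule exI, rule bexI[OF _ id_homogeneous]) (use v(2) in auto)
  next
    case (insert i I)
    have "\<exists>e. \<exists>y\<in>homogeneous e. y v \<noteq> 0 \<and> (\<forall>i\<in>I. \<forall>x\<in>F i. x (y v) = 0)"
      by (rule insert.IH) (use insert.prems in auto)
    then obtain e y where y: "y \<in> homogeneous e" "y v \<noteq> 0"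
        "\<forall>i\<in>I. \<forall>x\<in>F i. x (y v) = 0"
      by blast
    have "\<exists>e'. \<exists>y'\<in>homogeneous e'. y' (y v) \<noteq> 0 \<and> (\<forall>x\<in>F i. x (y' (y v)) = 0)"
      by (rule family_common_kernel[OF _ homogeneousD(2)[OF y(1) v(1)] y(2), where d = "deg i"])
        (use insert.prems in auto)
    then obtain e' y' where y': "y' \<in> homogeneous e'" "y' (y v) \<noteq> 0"
        "\<forall>x\<in>F i. x (y' (y v)) = 0"
      by blast
    have "x (y' (y v)) = 0" if "j \<in> I" "x \<in> F j" for j x
    proof -
      have "x \<in> homogeneous (deg j)" using insert.prems that by auto
      then have "x (y' (y v)) = y' (x (y v))"
        by (intro T_algebra_commute homogeneousD(1)[OF y'(1)] homogeneousD(1))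
      also have "x (y v) = 0" using y(3) that by blast
      also have "y' 0 = 0"
        by (rule clinear_simps(3)[OF T_algebra_linear[OF homogeneousD(1)[OF y'(1)]]])
      finally show ?thesis .
    qed
    note kernel = this
  show ?case by (rule exI, rule bexI[OF _ homogeneous_comp[OF y'(1) y(1)]]) (use kernel y' in auto)
  qed
  then show ?thesis using that by blast
qed

end

section \<open>Collinearity of exponents\<close>

text \<open>Some \<open>2 \<times> 2\<close> minor of the matrix with columns \<open>a\<close>, \<open>b\<close> is nonzero; in particular \<open>a, b \<noteq> 0\<close>.\<close>

definition noncollinear :: "int ^ 'n \<Rightarrow> int ^ 'n \<Rightarrow> bool"
  where "noncollinear a b \<longleftrightarrow> (\<exists>p q. vec_nth a p * vec_nth b q \<noteq> vec_nth a q * vec_nth b p)"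

lemma noncollinear_scale: "k \<noteq> 0 \<Longrightarrow> noncollinear a (k *s b) \<longleftrightarrow> noncollinear a b"
  by (simp add: noncollinear_def mult.left_commute)

lemma noncollinear_add: "\<not> noncollinear a c \<Longrightarrow> noncollinear a (c + b) \<longleftrightarrow> noncollinear a b"
  by (simp add: noncollinear_def distrib_left)

lemma noncollinear_add_multiple: "noncollinear a (b + k *s a) \<longleftrightarrow> noncollinear a b"
  by (simp add: noncollinear_def distrib_left mult.left_commute mult.commute)

lemma noncollinear_nonzero: "noncollinear a b \<Longrightarrow> a \<noteq> 0" "noncollinear a b \<Longrightarrow> b \<noteq> 0"
  by (auto simp: noncollinear_def)

lemma noncollinear_transfer:
  assumes "\<not> noncollinear a r" "r \<noteq> 0" "noncollinear a c"
  shows "noncollinear c r"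
proof (rule ccontr)
  assume "\<not> noncollinear c r"
  then have c: "vec_nth c p * vec_nth r q = vec_nth c q * vec_nth r p" for p q
    by (simp add: noncollinear_def)
  have a: "vec_nth a p * vec_nth r q = vec_nth a q * vec_nth r p" for p q
    using assms(1) by (simp add: noncollinear_def)
  obtain s where s: "vec_nth r s \<noteq> 0"
    using assms(2) by (auto simp: Finite_Cartesian_Product.vec_eq_iff)
  have "vec_nth a p * vec_nth c q = vec_nth a q * vec_nth c p" for p q
  proof -
    have "(vec_nth a p * vec_nth r s) * (vec_nth c q * vec_nth r s)
        = (vec_nth a q * vec_nth r s) * (vec_nth c p * vec_nth r s)"
      unfolding a[of _ s] c[of _ s] by (simp only: mult_ac)
    then have "(vec_nth a p * vec_nth c q) * (vec_nth r s * vec_nth r s)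
        = (vec_nth a q * vec_nth c p) * (vec_nth r s * vec_nth r s)"
      by (simp only: mult_ac)
    then show ?thesis using s by simp
  qed
  then show False using assms(3) by (simp add: noncollinear_def)
qed

lemma exists_other_index:
  assumes "CARD('n::finite) \<ge> 2"
  shows "\<exists>l :: 'n. l \<noteq> j"
proof (rule ccontr)
  assume "\<not> ?thesis"
  then have "UNIV = {j}" by auto
  then have "CARD('n) = card {j}" by (rule arg_cong)
  then show False using assms by simp
qed

lemma exists_noncollinear:
  assumes "CARD('n::finite) \<ge> 2" "a \<noteq> (0 :: int ^ 'n)"
  obtains c where "noncollinear a c"
proof -
  obtain j where j: "vec_nth a j \<noteq> 0"
    using assms(2) by (auto simp: Finite_Cartesian_Product.vec_eq_iff)
  obtain l where "l \<noteq> j" using exists_other_index[OF assms(1)] by blast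
  then have "noncollinear a (axis l 1)"
    unfolding noncollinear_def using j by (intro exI[of _ j] exI[of _ l]) (simp add: axis_def)
  then show ?thesis by (rule that)
qed

lemma pairing_scale_right: "pairing u (k *s r) = of_int k * pairing u r"
  by (simp add: pairing_def sum_distrib_left mult_ac)

text \<open>
  For such \<open>u\<close> the operator \<open>D(u, x)\<close> belongs to \<open>S\<^sub>N\<close> and \<open>[D(u, x), t\<^sup>a] = t\<^sup>a\<^sup>+\<^sup>x\<close>.
\<close>

lemma exists_orthogonal:
  assumes "noncollinear a x"
  obtains u where "pairing u x = 0" "pairing u a = 1"
proof -
  obtain p q where pq: "vec_nth a p * vec_nth x q \<noteq> vec_nth a q * vec_nth x p"
    using assms by (auto simp: noncollinear_def)
  define u where "u = complex_of_int (vec_nth x q) *s axis p 1 - complex_of_int (vec_nth x p) *s axis q 1"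
  have ux: "pairing u x = 0" by (simp add: u_def pairing_simps pairing_axis)
  have "pairing u a = of_int (vec_nth x q * vec_nth a p - vec_nth x p * vec_nth a q)"
    by (simp add: u_def pairing_simps pairing_axis)
  also have "\<dots> \<noteq> 0" using pq by (simp only: of_int_eq_0_iff) (simp add: mult.commute)
  finally have "pairing u a \<noteq> 0" .
  then show ?thesis
    using that[of "(1 / pairing u a) *s u"] ux by (simp add: pairing_simps)
qed

section \<open>The key vanishing lemma\<close>

context bounded_irreducible_module
begin

text \<open>If \<open>t\<^sup>r\<close> and \<open>t\<^sup>s\<close> kill \<open>v\<close>, they have to be absorbed by the two derivations, one each.\<close>

lemma T_T_D_D:
  assumes "pairing u q = 0" "pairing u' q' = 0" "T r 1 v = 0" "T s 1 v = 0"
  shows "T r 1 (T s 1 (D u q b (D u' q' b' v)))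
    = (pairing u r * pairing u' s) *\<^sub>C T (q + r) b (T (q' + s) b' v)
      + (pairing u s * pairing u' r) *\<^sub>C T (q + s) b (T (q' + r) b' v)"
proof -
  have swap: "T r 1 (T p c v) = 0" for p c
    using assms(3) T_T[of r 1 p c v] by (simp add: act_simps)
  have 1: "T s 1 (D u q b (D u' q' b' v))
      = - (pairing u' s *\<^sub>C D u q b (T (q' + s) b' v)) - pairing u s *\<^sub>C T (q + s) b (D u' q' b' v)"
    by (simp add: T_D assms act_simps)
  have 2: "T r 1 (D u q b (T (q' + s) b' v)) = - (pairing u r *\<^sub>C T (q + r) b (T (q' + s) b' v))"
    by (simp add: T_D assms(1) swap act_simps)
  have "T r 1 (T (q + s) b (D u' q' b' v)) = T (q + s) b (T r 1 (D u' q' b' v))" by (rule T_T)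
  also have "\<dots> = - (pairing u' r *\<^sub>C T (q + s) b (T (q' + r) b' v))"
    by (simp add: T_D assms act_simps)
  finally have 3: "T r 1 (T (q + s) b (D u' q' b' v))
      = - (pairing u' r *\<^sub>C T (q + s) b (T (q' + r) b' v))" .
  show ?thesis
    unfolding 1 by (simp add: act_simps 2 3 scaleC_scaleC mult.commute)
qed

text \<open>
  Uniform boundedness is exploited here. For \<open>j = 1, \<dots>, M + 1\<close> the vectors
  \<open>w\<^sub>j = D(u\<^sub>j, b - j a) \<beta> \<cdot> D(u\<^sub>j', b' + j a) \<beta>' \<cdot> v\<close> have the same weight, so they satisfy a
  nontrivial relation \<open>\<Sum> c\<^sub>j w\<^sub>j = 0\<close>. Applying \<open>t\<^sup>i\<^sup>a t\<^sup>-\<^sup>i\<^sup>a\<close>, which kills \<open>v\<close>, turns \<open>w\<^sub>j\<close> into a nonzero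
  multiple of
  \<open>t\<^sup>b\<^sup>+\<^sup>(\<^sup>i\<^sup>-\<^sup>j\<^sup>)\<^sup>a \<beta> t\<^sup>b\<^sup>'\<^sup>-\<^sup>(\<^sup>i\<^sup>-\<^sup>j\<^sup>)\<^sup>a \<beta>' v + t\<^sup>b\<^sup>-\<^sup>(\<^sup>i\<^sup>+\<^sup>j\<^sup>)\<^sup>a \<beta> t\<^sup>b\<^sup>'\<^sup>+\<^sup>(\<^sup>i\<^sup>+\<^sup>j\<^sup>)\<^sup>a \<beta>' v\<close>.
  When \<open>t\<^sup>b\<^sup>-\<^sup>k\<^sup>a \<beta>\<close> kills \<open>v\<close> for \<open>k\<close> in a window of length \<open>2 M + 2\<close>, the second summand vanishes and
  the first one vanishes for \<open>j > i\<close>. With \<open>i\<close> the least index such that \<open>c\<^sub>i \<noteq> 0\<close>, only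
  \<open>t\<^sup>b \<beta> t\<^sup>b\<^sup>' \<beta>' v\<close> survives. A window on one side of \<open>b\<close> suffices, and
  \<open>b'\<close> is only required not to be collinear to \<open>a\<close>.
\<close>

lemma window_vanishing:
  assumes v: "v \<in> W \<nu>"
    and ab: "noncollinear a b" "noncollinear a b'"
    and multiples: "\<And>k. k \<noteq> 0 \<Longrightarrow> \<bar>k\<bar> \<le> int M + 1 \<Longrightarrow> T (k *s a) 1 v = 0"
    and window: "\<And>k. 1 \<le> k \<Longrightarrow> k \<le> 2 * int M + 2 \<Longrightarrow> T (b - k *s a) \<beta> v = 0"
  shows "T b \<beta> (T b' \<beta>' v) = 0"
proof -
  \<comment> \<open>Indices start at 0, so the multiple of \<open>a\<close> that belongs to \<open>j\<close> is \<open>j + 1\<close>.\<close>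
  define s where "s j = int (Suc j)" for j
  define q where "q j = b - s j *s a" for j
  define q' where "q' j = b' + s j *s a" for j
  have "q j = b + (- s j) *s a" for j
    by (simp add: q_def Finite_Cartesian_Product.vec_eq_iff)
  then have "noncollinear a (q j)" "noncollinear a (q' j)" for j
    using ab by (simp_all only: q'_def noncollinear_add_multiple)
  then have "\<exists>u. pairing u (q j) = 0 \<and> pairing u a = 1" "\<exists>u. pairing u (q' j) = 0 \<and> pairing u a = 1"
    for j by (meson exists_orthogonal)+
  then obtain u u' where u: "\<And>j. pairing (u j) (q j) = 0" "\<And>j. pairing (u j) a = 1"
    and u': "\<And>j. pairing (u' j) (q' j) = 0" "\<And>j. pairing (u' j) a = 1" by metis
  define w where "w j = D (u j) (q j) \<beta> (D (u' j) (q' j) \<beta>' v)" for j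
  have "w j \<in> W (\<nu> + cvec_of (b + b'))" for j
  proof -
    have "w j \<in> W (\<nu> + cvec_of (q' j) + cvec_of (q j))"
      unfolding w_def by (intro D_W v u u')
    also have "\<nu> + cvec_of (q' j) + cvec_of (q j) = \<nu> + cvec_of (b + b')"
      by (simp add: cvec_of_def q_def q'_def Finite_Cartesian_Product.vec_eq_iff)
    finally show ?thesis .
  qed
  then obtain c i where c: "i \<le> M" "c i \<noteq> 0" "\<And>j. j < i \<Longrightarrow> c j = 0" "(\<Sum>j\<le>M. c j *\<^sub>C w j) = 0"
    using dim_at_mostE[OF dim_at_most, of w] by metis
  let ?A = "s i *s a" and ?A' = "(- s i) *s a"
  let ?\<Phi> = "\<lambda>j. T (q j + ?A) \<beta> (T (q' j + ?A') \<beta>' v) + T (q j + ?A') \<beta> (T (q' j + ?A) \<beta>' v)"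
  have s: "1 \<le> s j" "j \<le> M \<Longrightarrow> s j \<le> int M + 1" for j by (simp_all add: s_def)
  have ortho: "T ?A 1 (T ?A' 1 (w j)) = (- (of_int (s i))\<^sup>2) *\<^sub>C ?\<Phi> j" for j
  proof -
    have "T ?A 1 v = 0" "T ?A' 1 v = 0"
      using s(1)[of i] s(2)[OF c(1)] by (auto intro!: multiples)
    then show ?thesis
      unfolding w_def
      by (subst T_T_D_D) (simp_all add: u u' pairing_scale_right power2_eq_square scaleC_add_right)
  qed
  have killed: "T (b - k *s a) \<beta> (T p \<beta>' v) = 0" if "1 \<le> k" "k \<le> 2 * int M + 2" for k p
    using window[OF that] T_T[of "b - k *s a" \<beta> p \<beta>' v] by (simp add: act_simps)
  have q: "q j + ?A = b - (s j - s i) *s a" "q j + ?A' = b - (s j + s i) *s a" for j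
    by (simp_all add: q_def Finite_Cartesian_Product.vec_eq_iff algebra_simps)
  have second: "T (q j + ?A') \<beta> (T p \<beta>' v) = 0" if "j \<le> M" for j p
    unfolding q by (rule killed) (use s(1)[of i] s(1)[of j] s(2)[OF c(1)] s(2)[OF that] in auto)
  have first: "T (q j + ?A) \<beta> (T p \<beta>' v) = 0" if "j \<le> M" "i < j" for j p
    unfolding q by (rule killed) (use that s(1)[of i] s(2)[OF that(1)] in \<open>auto simp: s_def\<close>)
  have "q i + ?A = b" "q' i + ?A' = b'"
    by (simp_all add: q_def q'_def Finite_Cartesian_Product.vec_eq_iff)
  then have diag: "?\<Phi> i = T b \<beta> (T b' \<beta>' v)" using second[OF c(1)] by simp
  have "0 = T ?A 1 (T ?A' 1 (\<Sum>j\<le>M. c j *\<^sub>C w j))" by (simp add: c(4) act_simps)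
  also have "\<dots> = (\<Sum>j\<le>M. c j *\<^sub>C ((- (of_int (s i))\<^sup>2) *\<^sub>C ?\<Phi> j))"
    by (simp only: act_simps ortho)
  also have "\<dots> = (\<Sum>j\<in>{i}. c j *\<^sub>C ((- (of_int (s i))\<^sup>2) *\<^sub>C ?\<Phi> j))"
  proof (rule sum.mono_neutral_right; (intro ballI)?)
    fix j assume "j \<in> {..M} - {i}"
    then have "j \<le> M" and "j < i \<or> i < j" by auto
    then have "c j = 0 \<or> ?\<Phi> j = 0" using c(3) first second by auto
    then show "c j *\<^sub>C ((- (of_int (s i))\<^sup>2) *\<^sub>C ?\<Phi> j) = 0"
      by (elim disjE) (simp_all only: cvec.scale_zero_left cvec.scale_zero_right)
  qed (use c(1) in auto)
  also have "\<dots> = (c i * (- (of_int (s i))\<^sup>2)) *\<^sub>C T b \<beta> (T b' \<beta>' v)"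
    by (simp only: sum.insert finite.emptyI sum.empty empty_iff not_False_eq_True add_0_right diag
        scaleC_scaleC)
  finally have "(c i * (- (of_int (s i))\<^sup>2)) *\<^sub>C T b \<beta> (T b' \<beta>' v) = 0" by simp
  moreover have "c i * (- (of_int (s i))\<^sup>2) \<noteq> 0" using c(2) s(1)[of i] by simp
  ultimately show ?thesis by (simp only: cvec.scale_eq_0_iff) simp
qed

section \<open>The operators \<open>t\<^sup>r\<close> are injective\<close>

text \<open>
  Only \<open>v = 0\<close> is killed by all \<open>t\<^sup>r b\<close> with \<open>r \<noteq> 0\<close>: such vectors form a submodule, since
  \<open>[t\<^sup>r b, D(u, s) b']\<close> is a multiple of \<open>t\<^sup>r\<^sup>+\<^sup>s b b'\<close> with factor 0 when \<open>r + s = 0\<close>.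
\<close>

lemma zero_if_killed:
  assumes "\<And>r b. r \<noteq> 0 \<Longrightarrow> T r b v = 0"
  shows "v = 0"
proof -
  define U where "U = {v. \<forall>r b. r \<noteq> 0 \<longrightarrow> T r b v = 0}"
  have "csubspace U" by (auto simp: cvec.subspace_def U_def act_simps)
  moreover have "D u s b v \<in> U" if u: "pairing u s = 0" and v: "v \<in> U" for u s b v
  proof -
    have "T r b' (D u s b v) = 0" if r: "r \<noteq> 0" for r b'
    proof (cases "s + r = 0")
      case True
      then have "pairing u r = 0" using u pairing_simps(4)[of u s r] by (simp add: pairing_simps)
      then show ?thesis using v r by (simp add: T_D[OF u] U_def act_simps)
    next
      case False
      then show ?thesis using v r by (simp add: T_D[OF u] U_def act_simps)
    qed
    then show ?thesis by (simp add: U_def)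
  qed
  moreover have "T s b v \<in> U" if "v \<in> U" for s b v
  proof -
    have "T r b' (T s b v) = 0" if "r \<noteq> 0" for r b'
      using that \<open>v \<in> U\<close> T_T[of r b' s b v] by (simp add: U_def act_simps)
    then show ?thesis by (simp add: U_def)
  qed
  ultimately have "U = {0} \<or> U = UNIV" by (rule submodule_trivial)
  moreover have "U \<noteq> UNIV" using T_nontrivial unfolding U_def by blast
  moreover have "v \<in> U" using assms by (simp add: U_def)
  ultimately show ?thesis by blast
qed

text \<open>
  If \<open>v\<close> is killed off the line through \<open>a\<close>, then for \<open>r\<close> on that line and any direction \<open>c\<close> off it
  the windows \<open>r - k c\<close> come for free, and \<open>t\<^sup>r b v\<close> is killed by everything.
\<close>

lemma zero_if_killed_off_line:
  assumes a: "a \<noteq> 0" and v: "v \<in> W \<nu>" "\<And>r b. noncollinear a r \<Longrightarrow> T r b v = 0"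
  shows "v = 0"
proof (rule zero_if_killed)
  fix r :: "int ^ 'n" and b assume r: "r \<noteq> 0"
  obtain c where ac: "noncollinear a c" using exists_noncollinear[OF rank a] .
  show "T r b v = 0"
  proof (cases "noncollinear a r")
    case False
    have cr: "noncollinear c r" by (rule noncollinear_transfer[OF False r ac])
    have minus: "r - k *s c = r + (- k) *s c" for k
      by (simp add: Finite_Cartesian_Product.vec_eq_iff)
    have multiples: "T (k *s c) 1 v = 0" if "k \<noteq> 0" for k
      using ac that by (simp add: v(2) noncollinear_scale)
    have window: "T (r - k *s c) b v = 0" if "1 \<le> k" for k
    proof (rule v(2))
      have "- k \<noteq> 0" using that by simp
      then show "noncollinear a (r - k *s c)"
        unfolding minus using noncollinear_add[OF False] noncollinear_scale ac by blast
    qed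
    show ?thesis
    proof (rule zero_if_killed)
      fix s :: "int ^ 'n" and b' assume s: "s \<noteq> 0"
      show "T s b' (T r b v) = 0"
      proof (cases "noncollinear a s")
        case True
        then show ?thesis using v(2)[of s b'] T_T[of s b' r b v] by (simp add: act_simps)
      next
        case False
        have "noncollinear c s" by (rule noncollinear_transfer[OF False s ac])
        then have "T r b (T s b' v) = 0"
          using window_vanishing[OF v(1) cr] multiples window by blast
        then show ?thesis using T_T[of s b' r b v] by simp
      qed
    qed
  qed (rule v(2))
qed

text \<open>
  A weight vector \<open>v\<close> killed by all \<open>t\<^sup>r b\<close> with \<open>r \<noteq> 0\<close> in a large enough box vanishes. By
  \<open>window_vanishing\<close> a window next to \<open>r\<close> makes \<open>t\<^sup>r b v\<close> a vector killed off a line, hence 0.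
  Vanishing therefore spreads from the box to the exponents off the coordinate axes, by induction on
  \<open>\<Sum> \<bar>r\<^sub>i\<bar>\<close> moving along an axis, and from there to the axes, moving along another axis.
\<close>

lemma zero_if_killed_in_box:
  assumes v: "v \<in> W \<nu>"
    and box: "\<And>r b. r \<noteq> 0 \<Longrightarrow> (\<And>i. \<bar>vec_nth r i\<bar> \<le> 2 * int M + 2) \<Longrightarrow> T r b v = 0"
  shows "v = 0"
proof -
  have axis_nth: "vec_nth (k *s axis j e) i = (if i = j then k * e else 0)"
    for k e :: int and i j :: 'n
    by (simp add: axis_def)
  have step: "T r b v = 0"
    if e: "\<bar>e\<bar> = 1" and l: "l \<noteq> j" "vec_nth r l \<noteq> 0"
      and window: "\<And>k. 1 \<le> k \<Longrightarrow> k \<le> 2 * int M + 2 \<Longrightarrow> T (r - k *s axis j e) b v = 0"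
    for r b e j l
  proof -
    let ?a = "axis j e :: int ^ 'n"
    have "vec_nth ?a j * vec_nth r l \<noteq> vec_nth ?a l * vec_nth r j"
      using e l by (auto simp: axis_def)
    then have ar: "noncollinear ?a r" unfolding noncollinear_def by blast
    have multiples: "T (k *s ?a) 1 v = 0" if k: "k \<noteq> 0" "\<bar>k\<bar> \<le> int M + 1" for k
    proof (rule box)
      have "vec_nth (k *s ?a) j \<noteq> 0" using k e by (auto simp: axis_nth)
      then show "k *s ?a \<noteq> 0" by auto
      show "\<bar>vec_nth (k *s ?a) i\<bar> \<le> 2 * int M + 2" for i
        unfolding axis_nth using k e by (simp add: abs_mult)
    qed
    have "T s b' (T r b v) = 0" if "noncollinear ?a s" for s b'
      using window_vanishing[OF v ar that multiples window] T_T[of s b' r b v] by simp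
    then show ?thesis by (rule zero_if_killed_off_line[OF noncollinear_nonzero(1)[OF ar] T_W[OF v]])
  qed
  have off_axes: "T r b v = 0" if "p \<noteq> q" "vec_nth r p \<noteq> 0" "vec_nth r q \<noteq> 0" for r b p q
    using that
  proof (induction "nat (\<Sum>i\<in>UNIV. \<bar>vec_nth r i\<bar>)" arbitrary: r rule: less_induct)
    case less
    show ?case
    proof (cases "\<forall>i. \<bar>vec_nth r i\<bar> \<le> 2 * int M + 2")
      case True
      moreover have "r \<noteq> 0" using less.prems(2) by auto
      ultimately show ?thesis using box by blast
    next
      case False
      then obtain j where j: "2 * int M + 2 < \<bar>vec_nth r j\<bar>" by (auto simp: not_le)
      define e where "e = sgn (vec_nth r j)"
      have e: "\<bar>e\<bar> = 1" "e * vec_nth r j = \<bar>vec_nth r j\<bar>"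
        using j by (auto simp: e_def abs_sgn_eq sgn_if)
      obtain l where l: "l \<noteq> j" "vec_nth r l \<noteq> 0" using less.prems by metis
      show ?thesis
      proof (rule step[OF e(1) l])
        fix k :: int assume k: "1 \<le> k" "k \<le> 2 * int M + 2"
        let ?r = "r - k *s axis j e"
        have nth: "vec_nth ?r i = (if i = j then vec_nth r i - k * e else vec_nth r i)" for i
          by (simp add: axis_def)
        have rj: "\<bar>vec_nth ?r j\<bar> < \<bar>vec_nth r j\<bar>" "vec_nth ?r j \<noteq> 0"
          unfolding nth using j k by (auto simp: e_def sgn_if)
        have "(\<Sum>i\<in>UNIV. \<bar>vec_nth ?r i\<bar>) < (\<Sum>i\<in>UNIV. \<bar>vec_nth r i\<bar>)"
        proof (rule sum_strict_mono_ex1)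
          show "\<forall>i\<in>UNIV. \<bar>vec_nth ?r i\<bar> \<le> \<bar>vec_nth r i\<bar>"
            using rj(1) nth by (metis less_imp_le order_refl)
          show "\<exists>i\<in>UNIV. \<bar>vec_nth ?r i\<bar> < \<bar>vec_nth r i\<bar>" using rj(1) by blast
        qed simp
        moreover have "0 \<le> (\<Sum>i\<in>UNIV. \<bar>vec_nth ?r i\<bar>)" by (simp add: sum_nonneg)
        ultimately have "nat (\<Sum>i\<in>UNIV. \<bar>vec_nth ?r i\<bar>) < nat (\<Sum>i\<in>UNIV. \<bar>vec_nth r i\<bar>)"
          by linarith
        moreover have "vec_nth ?r p \<noteq> 0" "vec_nth ?r q \<noteq> 0"
          using less.prems rj(2) nth by metis+
        ultimately show "T ?r b v = 0" using less.hyps less.prems(1) by blast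
      qed
    qed
  qed
  have "T r b v = 0" if "r \<noteq> 0" for r b
  proof (cases "\<exists>p q. p \<noteq> q \<and> vec_nth r p \<noteq> 0 \<and> vec_nth r q \<noteq> 0")
    case True
    then show ?thesis using off_axes by blast
  next
    case False
    obtain j where j: "vec_nth r j \<noteq> 0"
      using \<open>r \<noteq> 0\<close> by (auto simp: Finite_Cartesian_Product.vec_eq_iff)
    obtain l where l: "l \<noteq> j" using exists_other_index[OF rank] by blast
    then have rl: "vec_nth r l = 0" using False j by blast
    show ?thesis
    proof (rule step[of 1 j l])
      fix k :: int assume "1 \<le> k"
      then show "T (r - k *s axis l 1) b v = 0"
        using l j rl by (intro off_axes[of j l]) (auto simp: axis_def)
    qed (use l j in auto)
  qed
  then show ?thesis by (rule zero_if_killed)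
qed

lemma finite_box: "finite {r :: int ^ 'n. \<forall>i. \<bar>vec_nth r i\<bar> \<le> w}"
proof (rule finite_subset)
  show "{r :: int ^ 'n. \<forall>i. \<bar>vec_nth r i\<bar> \<le> w} \<subseteq> vec_lambda ` (UNIV \<rightarrow>\<^sub>E {- w..w})"
  proof
    fix r :: "int ^ 'n" assume "r \<in> {r. \<forall>i. \<bar>vec_nth r i\<bar> \<le> w}"
    then have "vec_nth r \<in> UNIV \<rightarrow>\<^sub>E {- w..w}" by (auto simp: PiE_UNIV_domain abs_le_iff minus_le_iff)
    then show "r \<in> vec_lambda ` (UNIV \<rightarrow>\<^sub>E {- w..w})" by (metis image_eqI vec_nth_inverse)
  qed
  show "finite (vec_lambda ` (UNIV \<rightarrow>\<^sub>E {- w..w}) :: (int ^ 'n) set)"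
    by (intro finite_imageI finite_PiE) auto
qed

text \<open>Otherwise the finitely many degrees in the box would have a common kernel vector.\<close>

lemma not_all_locally_nilpotent:
  assumes "\<And>r b. r \<noteq> 0 \<Longrightarrow> locally_nilpotent (T r b)"
  shows False
proof -
  obtain \<nu> v where v: "v \<in> W \<nu>" "v \<noteq> 0" by (rule exists_nonzero_weight_vector)
  let ?I = "{r :: int ^ 'n. \<forall>i. \<bar>vec_nth r i\<bar> \<le> 2 * int M + 2} - {0}"
  obtain e y where y: "y \<in> homogeneous e" "y v \<noteq> 0"
    and killed: "\<And>r x. r \<in> ?I \<Longrightarrow> x \<in> range (T r) \<Longrightarrow> x (y v) = 0"
    by (rule finite_families_common_kernel[of ?I "\<lambda>r. range (T r)" "\<lambda>r. r", OF _ _ v])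
      (use finite_box assms T_homogeneous in auto)
  have "y v = 0"
  proof (rule zero_if_killed_in_box)
    show "y v \<in> W (\<nu> + cvec_of e)" by (rule homogeneousD(2)[OF y(1) v(1)])
    fix r :: "int ^ 'n" and b assume "r \<noteq> 0" "\<And>i. \<bar>vec_nth r i\<bar> \<le> 2 * int M + 2"
    then show "T r b (y v) = 0" using killed[of r "T r b"] by simp
  qed
  then show False using y(2) by contradiction
qed

text \<open>\<open>t\<^sup>r b\<close> is a derivative of \<open>t\<^sup>a\<close>.\<close>

lemma T_nilpotent_noncollinear:
  assumes "noncollinear a r" and nil: "\<And>v. (T a 1 ^^ k) v = 0"
  shows "(T r b ^^ (2 * k)) v = 0"
proof -
  have "noncollinear a (r - a)"
    using assms(1) noncollinear_add_multiple[of a r "-1"]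
    by (simp add: noncollinear_def algebra_simps)
  then obtain u where u: "pairing u (r - a) = 0" "pairing u a = 1" by (rule exists_orthogonal)
  have y: "T r b = commutator (D u (r - a) b) (T a 1)"
    by (simp add: commutator_D_T u scaleC_one fun_eq_iff)
  show ?thesis
    by (rule derivation_nilpotent[OF linear_vec linear_vec y refl _ _ _ nil])
      (intro T_algebra_commute T_mem commutator_D_mem u)+
qed

lemma T_not_nilpotent:
  assumes a: "a \<noteq> 0" and nil: "\<And>v. (T a 1 ^^ k) v = 0"
  shows False
proof (rule not_all_locally_nilpotent)
  fix r :: "int ^ 'n" and b assume r: "r \<noteq> 0"
  show "locally_nilpotent (T r b)"
  proof (cases "noncollinear a r")
    case True
    show ?thesis
      by (rule locally_nilpotent_if_nilpotent) (rule T_nilpotent_noncollinear[OF True nil])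
  next
    case False
    obtain c where ac: "noncollinear a c" using exists_noncollinear[OF rank a] .
    have cr: "noncollinear c r" by (rule noncollinear_transfer[OF False r ac])
    show ?thesis
      by (rule locally_nilpotent_if_nilpotent)
        (rule T_nilpotent_noncollinear[OF cr T_nilpotent_noncollinear[OF ac nil]])
  qed
qed

text \<open>A locally nilpotent \<open>t\<^sup>a\<close> excludes injective elements of degree \<open>k a\<close> for every \<open>k \<noteq> 0\<close>.\<close>

lemma no_injective_of_opposite_degree:
  assumes a: "a \<noteq> 0" "locally_nilpotent (T a 1)" and k: "0 < k"
    and y: "y \<in> homogeneous (- (int k *s a))" "inj y"
  shows False
proof (rule T_not_nilpotent[OF a(1)])
  have "locally_nilpotent (T a 1 ^^ k)" by (rule locally_nilpotent_funpow[OF linear_vec a(2) k])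
  then show "(T a 1 ^^ (k * M)) v = 0" for v
    using nilpotent_if_compensated[OF homogeneous_funpow[OF T_homogeneous] _ y]
    by (simp add: funpow_mult)
qed

lemma inj_T_uminus:
  assumes "a \<noteq> 0" "inj (T a b)"
  shows "inj (T (- a) 1)"
proof (rule ccontr)
  assume "\<not> inj (T (- a) 1)"
  then have "locally_nilpotent (T (- a) 1)" using locally_nilpotent_or_inj[OF T_mem] by blast
  moreover have "T a b \<in> homogeneous (- (int 1 *s (- a)))"
    using T_homogeneous[of a b] by (simp add: vector_smult_lid)
  ultimately show False using no_injective_of_opposite_degree[of "- a" 1 "T a b"] assms by simp
qed

lemma no_injective_of_multiple_degree:
  assumes a: "a \<noteq> 0" "locally_nilpotent (T a 1)" and k: "k \<noteq> 0"
    and y: "y \<in> homogeneous (k *s a)" "inj y"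
  shows False
proof (cases "k < 0")
  case True
  then have "k *s a = - (int (nat (- k)) *s a)"
    by (simp add: Finite_Cartesian_Product.vec_eq_iff)
  then show ?thesis using no_injective_of_opposite_degree[OF a, of "nat (- k)" y] y True by simp
next
  case False
  have "\<not> inj (T (- a) 1)"
  proof
    assume "inj (T (- a) 1)"
    then have "inj (T (- (- a)) 1)" using inj_T_uminus[of "- a" 1] a(1) by simp
    then show False using not_inj_and_locally_nilpotent[OF _ a(2) linear_vec] by simp
  qed
  then have na: "locally_nilpotent (T (- a) 1)" using locally_nilpotent_or_inj[OF T_mem] by blast
  have "k *s a = - (int (nat k) *s (- a))"
    using False by (simp add: Finite_Cartesian_Product.vec_eq_iff)
  then show ?thesis using no_injective_of_opposite_degree[OF _ na, of "nat k" y] a(1) y False k by simp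
qed

text \<open>
  An injective \<open>t\<^sup>r b\<close> would make \<open>t\<^sup>-\<^sup>r\<close> injective, so without injective \<open>t\<^sup>s\<close> all \<open>t\<^sup>r b\<close> with
  \<open>r \<noteq> 0\<close> would be locally nilpotent.
\<close>

lemma exists_inj_T: "\<exists>b. b \<noteq> 0 \<and> inj (T b 1)"
proof (rule ccontr)
  assume none: "\<not> ?thesis"
  show False
  proof (rule not_all_locally_nilpotent)
    fix r :: "int ^ 'n" and b assume r: "r \<noteq> 0"
    have "\<not> inj (T r b)" using inj_T_uminus[OF r] none r by (metis neg_equal_0_iff_equal)
    then show "locally_nilpotent (T r b)" using locally_nilpotent_or_inj[OF T_mem] by blast
  qed
qed

text \<open>
  Suppose \<open>t\<^sup>b\<close> is injective and \<open>t\<^sup>a\<close> is not. No injective element has a degree \<open>k a\<close> with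
  \<open>k \<noteq> 0\<close>; therefore \<open>t\<^sup>k\<^sup>a\<close> and, since \<open>t\<^sup>-\<^sup>b\<close> is injective, \<open>t\<^sup>b\<^sup>-\<^sup>k\<^sup>a\<close> are locally nilpotent for
  \<open>k \<noteq> 0\<close>, and \<open>b\<close> is not collinear to \<open>a\<close>. On a common kernel vector of finitely many of them the
  window lemma gives \<open>t\<^sup>b t\<^sup>b v = 0\<close>.
\<close>

lemma inj_T:
  assumes a: "a \<noteq> 0"
  shows "inj (T a 1)"
proof (rule ccontr)
  assume "\<not> inj (T a 1)"
  then have nil: "locally_nilpotent (T a 1)" using locally_nilpotent_or_inj[OF T_mem] by blast
  note none = no_injective_of_multiple_degree[OF a nil]
  obtain b where b: "b \<noteq> 0" "inj (T b 1)" using exists_inj_T by blast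
  have multiples: "locally_nilpotent (T (k *s a) 1)" if "k \<noteq> 0" for k
    using none[OF that T_homogeneous] locally_nilpotent_or_inj[OF T_mem] by blast
  have window: "locally_nilpotent (T (b - k *s a) 1)" if "k \<noteq> 0" for k
  proof (rule ccontr)
    assume "\<not> locally_nilpotent (T (b - k *s a) 1)"
    then have "inj (T (b - k *s a) 1)" using locally_nilpotent_or_inj[OF T_mem] by blast
    then have inj: "inj (\<lambda>v. T (b - k *s a) 1 (T (- b) 1 v))"
      using inj_compose[OF _ inj_T_uminus[OF b]] by (simp add: comp_def)
    have deg: "(- k) *s a = (b - k *s a) + (- b)"
      by (simp add: Finite_Cartesian_Product.vec_eq_iff)
    show False
      by (rule none[of "- k", OF _ _ inj], use that in simp, unfold deg)
        (rule homogeneous_comp[OF T_homogeneous T_homogeneous])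
  qed
  have ab: "noncollinear a b"
  proof (rule ccontr)
    assume "\<not> noncollinear a b"
    then have col: "vec_nth a p * vec_nth b q = vec_nth a q * vec_nth b p" for p q
      by (simp add: noncollinear_def)
    obtain p where p: "vec_nth a p \<noteq> 0"
      using a by (auto simp: Finite_Cartesian_Product.vec_eq_iff)
    obtain q where "vec_nth b q \<noteq> 0"
      using b(1) by (auto simp: Finite_Cartesian_Product.vec_eq_iff)
    then have bp: "vec_nth b p \<noteq> 0" using col[of p q] p by auto
    \<comment> \<open>A power of the injective \<open>t\<^sup>b\<close> would have a degree that is a nonzero multiple of \<open>a\<close>.\<close>
    have deg: "int (nat \<bar>vec_nth a p\<bar>) *s b = (sgn (vec_nth a p) * vec_nth b p) *s a"
    proof -
      have "int (nat \<bar>vec_nth a p\<bar>) * vec_nth b i = sgn (vec_nth a p) * vec_nth b p * vec_nth a i" for i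
      proof -
        have "int (nat \<bar>vec_nth a p\<bar>) * vec_nth b i = sgn (vec_nth a p) * (vec_nth a p * vec_nth b i)"
          by (simp add: sgn_if)
        then show ?thesis by (simp only: col[of p i] mult_ac)
      qed
      then show ?thesis by (simp add: Finite_Cartesian_Product.vec_eq_iff)
    qed
    show False
    proof (rule none)
      show "sgn (vec_nth a p) * vec_nth b p \<noteq> 0" using p bp by (simp add: sgn_eq_0_iff)
      show "T b 1 ^^ nat \<bar>vec_nth a p\<bar> \<in> homogeneous ((sgn (vec_nth a p) * vec_nth b p) *s a)"
        using homogeneous_funpow[OF T_homogeneous[of b 1], of "nat \<bar>vec_nth a p\<bar>"] by (simp only: deg)
      show "inj (T b 1 ^^ nat \<bar>vec_nth a p\<bar>)" by (rule inj_fn[OF b(2)])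
    qed
  qed
  obtain \<nu> v where v: "v \<in> W \<nu>" "v \<noteq> 0" by (rule exists_nonzero_weight_vector)
  define I where "I = (\<lambda>k. k *s a) ` ({- (int M + 1)..int M + 1} - {0})
    \<union> (\<lambda>k. b - k *s a) ` {1..2 * int M + 2}"
  have "finite I" by (simp add: I_def)
  moreover have "x \<in> homogeneous s \<and> locally_nilpotent x" if "s \<in> I" "x \<in> {T s 1}" for s x
    using that multiples window T_homogeneous by (auto simp: I_def)
  ultimately obtain e y where y: "y \<in> homogeneous e" "y v \<noteq> 0"
    and killed: "\<And>s x. s \<in> I \<Longrightarrow> x \<in> {T s 1} \<Longrightarrow> x (y v) = 0"
    using finite_families_common_kernel[of I "\<lambda>s. {T s 1}" "\<lambda>s. s", OF _ _ v] by metis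
  have "T b 1 (T b 1 (y v)) = 0"
    by (rule window_vanishing[OF homogeneousD(2)[OF y(1) v(1)] ab ab]; rule killed)
      (auto simp: I_def abs_le_iff intro!: imageI)
  then have "T b 1 (T b 1 (y v)) = T b 1 (T b 1 0)" by (simp add: act_simps)
  then show False using b(2) y(2) by (simp add: inj_eq)
qed

text \<open>\<open>t\<^sup>0\<close> is central, so its kernel is a submodule.\<close>

lemma inj_T_zero: "inj (T 0 1)"
proof (rule clinear_injI[OF linear_vec])
  define U where "U = {v. T 0 1 v = 0}"
  have "csubspace U" by (auto simp: cvec.subspace_def U_def act_simps)
  moreover have "D u r b v \<in> U" if "pairing u r = 0" "v \<in> U" for u r b v
    using that by (simp add: U_def T_D pairing_simps act_simps)
  moreover have "T r b v \<in> U" if "v \<in> U" for r b v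
    using that T_T[of 0 1 r b v] by (simp add: U_def act_simps)
  ultimately have "U = {0} \<or> U = UNIV" by (rule submodule_trivial)
  moreover have "U \<noteq> UNIV" using T_zero_nontrivial unfolding U_def by blast
  moreover fix v assume "T 0 1 v = 0"
  ultimately show "v = 0" unfolding U_def by blast
qed

lemma inj_T_all: "inj (T r 1)"
  using inj_T inj_T_zero by (cases "r = 0") auto

lemma T_surj_on_weight_space:
  assumes "v \<in> W (\<nu> + cvec_of r)"
  obtains w where "w \<in> W \<nu>" "T r 1 w = v"
proof -
  let ?f = "\<lambda>v. T r 1 (T (- r) 1 v)"
  have shift_back: "T (- r) 1 w \<in> W \<nu>" if "w \<in> W (\<nu> + cvec_of r)" for w
  proof -
    have "\<nu> + cvec_of r + cvec_of (- r) = \<nu>"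
      by (simp add: cvec_of_def Finite_Cartesian_Product.vec_eq_iff)
    then show ?thesis using T_W[OF that, of "- r" 1] by (simp only:)
  qed
  have "v \<in> ?f ` W (\<nu> + cvec_of r)"
  proof (rule inj_imp_surj_on[OF dim_at_most _ subspace_W _ _ assms])
    show "?f w \<in> W (\<nu> + cvec_of r)" if "w \<in> W (\<nu> + cvec_of r)" for w
      by (rule T_W[OF shift_back[OF that]])
    show "clinear ?f" by (simp add: clinear_iff act_simps)
    show "inj ?f" using inj_compose[OF inj_T_all inj_T_all] by (simp add: comp_def)
  qed
  then show ?thesis using that shift_back by blast
qed

section \<open>Noninjective homogeneous elements vanish\<close>

text \<open>
  A noninjective homogeneous element is nilpotent, its degree being compensated by the injective
  \<open>t\<^sup>-\<^sup>d\<close>. The vectors killed by all homogeneous nilpotents form a submodule, since derivatives of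
  nilpotents are nilpotent. It is nonzero: the nilpotents of degree 0 have a common kernel vector,
  and \<open>t\<^sup>-\<^sup>e\<close> carries those of degree \<open>e\<close> to degree 0. Hence homogeneous nilpotents are 0.
\<close>

lemma homogeneous_not_inj_imp_zero:
  assumes x: "x \<in> homogeneous d" "\<not> inj x"
  shows "x v = 0"
proof -
  define N where "N e = {x \<in> homogeneous e. \<exists>k. \<forall>v. (x ^^ k) v = 0}" for e
  define U where "U = {v. \<forall>e. \<forall>x\<in>N e. x v = 0}"
  have lin: "clinear x" if "x \<in> N e" for x e
    using that homogeneousD(1) T_algebra_linear by (auto simp: N_def)
  have UD: "x v = 0" if "v \<in> U" "x \<in> N e" for x v e using that unfolding U_def by blast
  have "csubspace U"
    unfolding cvec.subspace_def
  proof (intro conjI ballI allI)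
    show "0 \<in> U" by (auto simp: U_def clinear_simps[OF lin])
    fix v assume v: "v \<in> U"
    show "c *\<^sub>C v \<in> U" for c
      unfolding U_def by (clarify, subst clinear_simps[OF lin], assumption) (simp add: UD[OF v])
    fix w assume w: "w \<in> U"
    show "v + w \<in> U"
      unfolding U_def by (clarify, subst clinear_simps[OF lin], assumption) (simp add: UD[OF v] UD[OF w])
  qed
  moreover have "D u r b v \<in> U" if u: "pairing u r = 0" and v: "v \<in> U" for u r b v
  proof -
    have "x (D u r b v) = 0" if x: "x \<in> N e" for x e
    proof -
      let ?y = "commutator (D u r b) x"
      obtain k where k: "\<And>v. (x ^^ k) v = 0" using x by (auto simp: N_def)
      have xA: "x \<in> T_algebra" using x homogeneousD(1) by (auto simp: N_def)
      have "(?y ^^ (2 * k)) v = 0" for v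
        by (rule derivation_nilpotent[OF lin[OF x] linear_vec refl refl _ _ _ k])
          (intro T_algebra_commute xA commutator_D_mem u)+
      moreover have "?y \<in> homogeneous (r + e)"
        by (rule homogeneous_commutator_D[OF u]) (use x in \<open>simp add: N_def\<close>)
      ultimately have "?y \<in> N (r + e)" unfolding N_def by blast
      then have "?y v = 0" "x v = 0" using v x by (auto simp: U_def)
      then show ?thesis by (simp add: commutator_def act_simps)
    qed
    then show ?thesis by (simp add: U_def)
  qed
  moreover have "T r b v \<in> U" if "v \<in> U" for r b v
  proof -
    have "x (T r b v) = 0" if x: "x \<in> N e" for x e
    proof -
      have "x (T r b v) = T r b (x v)"
        by (rule T_algebra_commute) (use x T_mem homogeneousD(1) in \<open>auto simp: N_def\<close>)
      then show ?thesis by (simp add: UD[OF \<open>v \<in> U\<close> x] act_simps)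
    qed
    then show ?thesis by (simp add: U_def)
  qed
  ultimately have "U = {0} \<or> U = UNIV" by (rule submodule_trivial)
  moreover have "U \<noteq> {0}"
  proof -
    obtain \<nu> v where v: "v \<in> W \<nu>" "v \<noteq> 0" by (rule exists_nonzero_weight_vector)
    have "\<exists>e. \<exists>y\<in>homogeneous e. y v \<noteq> 0 \<and> (\<forall>x\<in>N 0. x (y v) = 0)"
      by (rule family_common_kernel[OF _ v, where d = 0])
        (auto simp: N_def intro: locally_nilpotent_if_nilpotent)
    then obtain y where y: "y v \<noteq> 0" "\<And>x. x \<in> N 0 \<Longrightarrow> x (y v) = 0" by blast
    have "x (y v) = 0" if x: "x \<in> N e" for x e
    proof -
      have xh: "x \<in> homogeneous e" using x by (simp add: N_def)
      obtain k where k: "\<And>v. (x ^^ k) v = 0" using x by (auto simp: N_def)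
      let ?z = "\<lambda>v. T (- e) 1 (x v)"
      have "?z \<in> homogeneous 0" using homogeneous_comp[OF T_homogeneous[of "- e" 1] xh] by simp
      moreover have "(?z ^^ k) v = 0" for v
        using T_algebra_commute[OF T_mem homogeneousD(1)[OF xh]]
        by (subst funpow_comp) (simp_all add: k clinear_simps[OF clinear_funpow[OF linear_vec]])
      ultimately have "?z \<in> N 0" unfolding N_def by blast
      then have "T (- e) 1 (x (y v)) = T (- e) 1 0" using y(2) by (simp add: act_simps)
      then show ?thesis using inj_T_all by (simp only: inj_eq)
    qed
    then have "y v \<in> U" by (simp add: U_def)
    then show ?thesis using y(1) by blast
  qed
  ultimately have U: "v \<in> U" by blast
  have "locally_nilpotent x" using locally_nilpotent_or_inj[OF homogeneousD(1)[OF x(1)]] x(2) by blast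
  then have "(x ^^ M) v = 0" for v
    by (rule nilpotent_if_compensated[OF x(1) _ T_homogeneous inj_T_all])
  then have "x \<in> N d" using x(1) unfolding N_def by blast
  then show ?thesis using U by (simp add: U_def)
qed

end

section \<open>The matrix of a product and its eigenvectors\<close>

lemma ordered_basis_coordinates:
  assumes vs: "is_ordered_basis vs W" and w: "w \<in> W"
  obtains c where "w = (\<Sum>i<length vs. c i *\<^sub>C vs ! i)"
proof -
  have "w \<in> cspan (set vs)" using assms by (simp add: is_ordered_basis_def)
  then obtain u where "w = (\<Sum>v\<in>set vs. u v *\<^sub>C v)"
    by (auto simp: cvec.span_finite)
  also have "\<dots> = (\<Sum>i<length vs. u (vs ! i) *\<^sub>C vs ! i)"
    using vs by (intro sum.reindex_bij_betw[OF bij_betw_nth, symmetric]) (auto simp: is_ordered_basis_def)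
  finally show ?thesis by (rule that)
qed

lemma ordered_basis_independent:
  assumes vs: "is_ordered_basis vs W" and z: "(\<Sum>i<length vs. c i *\<^sub>C vs ! i) = 0"
    and i: "i < length vs"
  shows "c i = 0"
proof -
  have bij: "bij_betw (\<lambda>i. vs ! i) {..<length vs} (set vs)"
    using vs by (intro bij_betw_nth) (auto simp: is_ordered_basis_def)
  define u where "u v = c (inv_into {..<length vs} (\<lambda>i. vs ! i) v)" for v
  have u: "u (vs ! i) = c i" if "i < length vs" for i
    using bij that by (simp add: u_def bij_betw_def)
  have "(\<Sum>v\<in>set vs. u v *\<^sub>C v) = (\<Sum>i<length vs. u (vs ! i) *\<^sub>C vs ! i)"
    by (rule sum.reindex_bij_betw[OF bij, symmetric])
  also have "\<dots> = 0" using u z by simp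
  finally have "u (vs ! i) = 0"
    using vs i by (intro cvec.independentD[of "set vs" "set vs"]) (auto simp: is_ordered_basis_def)
  then show ?thesis using u[OF i] by simp
qed

context bounded_irreducible_module
begin

text \<open>The matrix is well defined because \<open>t\<^sup>m\<^sup>+\<^sup>n\<close> maps \<open>vs\<close> to a basis of the target weight space.\<close>

lemma B_mat_property:
  assumes vs: "is_ordered_basis vs (W \<nu>)"
  shows "B_mat act vs m n b b' \<in> carrier_mat (length vs) (length vs)"
    and "j < length vs \<Longrightarrow> T m b (T n b' (vs ! j))
      = (\<Sum>i<length vs. B_mat act vs m n b b' $$ (i, j) *\<^sub>C T (m + n) 1 (vs ! i))"
proof -
  let ?l = "length vs"
  let ?P = "\<lambda>B. B \<in> carrier_mat ?l ?l \<and> (\<forall>j<?l. T m b (T n b' (vs ! j))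
    = (\<Sum>i<?l. B $$ (i, j) *\<^sub>C T (m + n) 1 (vs ! i)))"
  have "\<exists>c. T m b (T n b' (vs ! j)) = (\<Sum>i<?l. c i *\<^sub>C T (m + n) 1 (vs ! i))" if j: "j < ?l" for j
  proof -
    have "vs ! j \<in> W \<nu>"
      using vs j cvec.span_base[of "vs ! j" "set vs"] by (simp add: is_ordered_basis_def)
    then have "T m b (T n b' (vs ! j)) \<in> W (\<nu> + cvec_of n + cvec_of m)" by (intro T_W)
    also have "\<nu> + cvec_of n + cvec_of m = \<nu> + cvec_of (m + n)" by (simp add: cvec_of_simps add_ac)
    finally obtain w where w: "w \<in> W \<nu>" "T (m + n) 1 w = T m b (T n b' (vs ! j))"
      by (rule T_surj_on_weight_space)
    obtain c where "w = (\<Sum>i<?l. c i *\<^sub>C vs ! i)" using ordered_basis_coordinates[OF vs w(1)] .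
    then have "T m b (T n b' (vs ! j)) = (\<Sum>i<?l. c i *\<^sub>C T (m + n) 1 (vs ! i))"
      using w(2) by (simp add: act_simps)
    then show ?thesis by (rule exI[of _ c])
  qed
  then have "\<forall>j. \<exists>c. j < ?l \<longrightarrow>
      T m b (T n b' (vs ! j)) = (\<Sum>i<?l. c i *\<^sub>C T (m + n) 1 (vs ! i))" by simp
  from choice[OF this] obtain c where c: "j < ?l \<Longrightarrow>
      T m b (T n b' (vs ! j)) = (\<Sum>i<?l. c j i *\<^sub>C T (m + n) 1 (vs ! i))" for j by auto
  have ex: "?P (mat ?l ?l (\<lambda>(i, j). c j i))" using c by simp
  have unique: "B = C" if B: "?P B" and C: "?P C" for B C
  proof (rule eq_matI)
    fix i j assume ij: "i < dim_row C" "j < dim_col C"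
    then have l: "i < ?l" "j < ?l" using C by auto
    have "T (m + n) 1 (\<Sum>i<?l. (B $$ (i, j) - C $$ (i, j)) *\<^sub>C vs ! i)
        = (\<Sum>i<?l. B $$ (i, j) *\<^sub>C T (m + n) 1 (vs ! i)) - (\<Sum>i<?l. C $$ (i, j) *\<^sub>C T (m + n) 1 (vs ! i))"
      by (simp add: act_simps cvec.scale_left_diff_distrib sum_subtractf)
    also have "\<dots> = T m b (T n b' (vs ! j)) - T m b (T n b' (vs ! j))"
      using B[THEN conjunct2, rule_format, OF l(2)] C[THEN conjunct2, rule_format, OF l(2)]
      by (simp only:)
    also have "\<dots> = T (m + n) 1 0" by (simp add: act_simps)
    finally have "(\<Sum>i<?l. (B $$ (i, j) - C $$ (i, j)) *\<^sub>C vs ! i) = 0"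
      using inj_T_all by (simp only: inj_eq)
    from ordered_basis_independent[OF vs this l(1)] show "B $$ (i, j) = C $$ (i, j)" by simp
  qed (use B C in auto)
  have "?P (B_mat act vs m n b b')"
    unfolding B_mat_def by (rule theI[of ?P, OF ex unique[OF _ ex]])
  then show "B_mat act vs m n b b' \<in> carrier_mat ?l ?l"
    and "j < ?l \<Longrightarrow> T m b (T n b' (vs ! j))
      = (\<Sum>i<?l. B_mat act vs m n b b' $$ (i, j) *\<^sub>C T (m + n) 1 (vs ! i))"
    by blast+
qed

lemma eigenvector_of_product:
  assumes vs: "is_ordered_basis vs (W \<nu>)" and ev: "eigenvalue (B_mat act vs m n b b') \<mu>"
  obtains v where "v \<noteq> 0" "T m b (T n b' v) = \<mu> *\<^sub>C T (m + n) 1 v"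
proof -
  let ?B = "B_mat act vs m n b b'" and ?l = "length vs"
  note B = B_mat_property[OF vs, where m = m and n = n and b = b and b' = b']
  obtain x where x: "x \<in> carrier_vec ?l" "x \<noteq> 0\<^sub>v ?l" "?B *\<^sub>v x = \<mu> \<cdot>\<^sub>v x"
    using ev B(1) unfolding eigenvalue_def eigenvector_def by auto
  define v where "v = (\<Sum>j<?l. (vec_index x j) *\<^sub>C vs ! j)"
  have "v \<noteq> 0"
  proof
    assume "v = 0"
    then have "vec_index x j = 0" if "j < ?l" for j
      using ordered_basis_independent[OF vs, of "\<lambda>j. vec_index x j"] that by (simp add: v_def)
    then have "x = 0\<^sub>v ?l" using x(1) by (intro eq_vecI) auto
    then show False using x(2) by contradiction
  qed
  have row: "(\<Sum>j<?l. ?B $$ (i, j) * vec_index x j) = \<mu> * vec_index x i" if i: "i < ?l" for i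
  proof -
    have "(\<Sum>j<?l. ?B $$ (i, j) * vec_index x j) = vec_index (?B *\<^sub>v x) i"
      using i x(1) B(1) by (auto simp: scalar_prod_def lessThan_atLeast0)
    then show ?thesis using x i by simp
  qed
  have "T m b (T n b' v)
      = (\<Sum>j<?l. vec_index x j *\<^sub>C (\<Sum>i<?l. ?B $$ (i, j) *\<^sub>C T (m + n) 1 (vs ! i)))"
    by (simp add: v_def act_simps B(2))
  also have "\<dots> = (\<Sum>j<?l. \<Sum>i<?l. (?B $$ (i, j) * vec_index x j) *\<^sub>C T (m + n) 1 (vs ! i))"
    by (simp add: cvec.scale_sum_right scaleC_scaleC mult.commute)
  also have "\<dots> = (\<Sum>i<?l. \<Sum>j<?l. (?B $$ (i, j) * vec_index x j) *\<^sub>C T (m + n) 1 (vs ! i))"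
    by (rule sum.swap)
  also have "\<dots> = (\<Sum>i<?l. (\<Sum>j<?l. ?B $$ (i, j) * vec_index x j) *\<^sub>C T (m + n) 1 (vs ! i))"
    by (simp add: cvec.scale_sum_left)
  also have "\<dots> = \<mu> *\<^sub>C T (m + n) 1 v"
    by (simp add: row v_def act_simps cvec.scale_sum_right scaleC_scaleC)
  finally show ?thesis using that \<open>v \<noteq> 0\<close> by blast
qed

lemma product_eq_scalar:
  assumes "v \<noteq> 0" "T m b (T n b' v) = \<mu> *\<^sub>C T (m + n) 1 v"
  shows "T m b (T n b' w) = \<mu> *\<^sub>C T (m + n) 1 w"
proof -
  let ?x = "\<lambda>v. T m b (T n b' v) - \<mu> *\<^sub>C T (m + n) 1 v"
  have "?x \<in> homogeneous (m + n)"
    by (intro homogeneous_diff_scaleC homogeneous_comp T_homogeneous)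
  moreover have "?x v = ?x 0" using assms(2) by (simp add: act_simps)
  then have "\<not> inj ?x" using assms(1) unfolding inj_def by blast
  ultimately have "?x w = 0" by (rule homogeneous_not_inj_imp_zero)
  then show ?thesis by simp
qed

end

theorem theorem3p8:
  fixes act :: "('n::finite sn_an, 'b::complex_comm_algebra) tensor \<Rightarrow> 'v::complex_vector \<Rightarrow> 'v"
    and wt :: "('n sn_an, 'b) tensor \<Rightarrow> complex"
    and vs :: "'v list"
    and m n :: "int ^ 'n"
    and b b' :: 'b
    and \<mu> :: complex
  assumes "CARD('n) \<ge> 2"
    and "finitely_generated_algebra TYPE('b)"
    and "lie_module act"
    and "irreducible_module act"
    and "weight_module act"
    and "uniformly_bounded act"
    and "\<exists>v. act (tens (an_t 0) 1) v \<noteq> 0"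
    and "\<exists>r. r \<noteq> 0 \<and> (\<exists>v. act (tens (an_t r) 1) v \<noteq> 0)"
    and "wt \<in> cartan_dual" and "weight_space act wt \<noteq> {0}"
    and "is_ordered_basis vs (weight_space act wt)"
    and "eigenvalue (B_mat act vs m n b b') \<mu>"
  shows "\<forall>v. act (tens (an_t m) b) (act (tens (an_t n) b') v) = \<mu> *\<^sub>C act (tens (an_t (m + n)) 1) v"
proof -
  obtain M where M: "\<And>\<nu>. dim_at_most M (eigenspace act \<nu>)"
    using eigenspace_dim_at_most[OF assms(3,6)] by blast
  interpret bounded_irreducible_module act M
    using assms(1,3,4,7,8) M eigenspaces_span[OF assms(3,5)]
    by (simp add: bounded_irreducible_module_def bounded_irreducible_module_axioms_def)
  obtain \<nu> where "weight_space act wt = W \<nu>"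
    using weight_space_eq_eigenspace[OF assms(3,9)] by blast
  then have "is_ordered_basis vs (W \<nu>)" using assms(11) by simp
  then obtain v where "v \<noteq> 0" "T m b (T n b' v) = \<mu> *\<^sub>C T (m + n) 1 v"
    using eigenvector_of_product[OF _ assms(12)] by blast
  then show ?thesis using product_eq_scalar by blast
qed

end
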